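(* For all positive integers $n$ and $q$, there is a bijection $\Phi$ between $q$-colored rooted unicellular maps with $n$ edges on orientable surfaces and tree-rooted maps with $n$ edges and vertex set $[q]=\{1,\dots,q\}$ on orientable surfaces. Moreover, for all $i,j\in[q]$, the number of edges with endpoints of colors $i,j$ in a $q$-colored unicellular map $U$ is equal to the number of edges between the vertices $i$ and $j$ in the tree-rooted map $\Phi(U)$.
   Context: Graphs are finite, undirected, and may have loops and multiple edges. A half-edge is an incidence between an edge and a vertex (a loop gives two half-edges at the same vertex). A \emph{map} is a cellular embedding (all faces, i.e. components of the complement, are simply connected) of a connected graph in a compact connected surface without boundary, considered up to homeomorphism; equivalently, a gluing of polygons along their edges in pairs. It is \emph{unicellular} if it has exactly one face. A map is \emph{rooted} by distinguishing an edge (the root-edge) together with a direction and a side of it; the root-vertex is the origin of the root-edge. Orientable rooted unicellular maps with $n$ edges correspond to the $(2n-1)!!$ ways of gluing in pairs the sides of a rooted $2n$-gon, each pair being glued in an orientable way (giving a cylinder). A map is \emph{$q$-colored} if its vertices are colored using every color in $[q]$ (adjacent vertices may have the same color). Rooted maps on orientable surfaces with underlying graph $G$ are identified with \emph{rooted rotation systems} of $G$: the choice of a root-vertex $v_0$, of a cyclic order of the half-edges incident to $v$ for each vertex $v\ne v_0$ (counterclockwise order around $v$), and of a total order of the half-edges incident to $v_0$ (counterclockwise order starting from the outgoing half of the root-edge). A map has vertex set $[q]$ if its vertices are labelled bijectively by $[q]$. A \emph{tree-rooted map} is a rooted map with a marked spanning tree. *)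

theory Defs
  imports Main "HOL-Combinatorics.Orbits" "HOL-Combinatorics.Permutations"
begin

(* Combinatorial encoding of rooted maps on oriented surfaces (rotation systems).
   Darts are half-edges; "ccw" sends a half-edge to the next one counterclockwise around
   its vertex, "opp" to the other half of its edge.  A dart is also an edge with a
   direction (outgoing at the vertex of the dart).  The side in the rooting of a map on an
   orientable surface amounts to the choice of an orientation of the surface, so a rooted
   map up to homeomorphism is a map on an oriented surface with a root dart, up to
   orientation- and root-preserving isomorphism. *)

record 'd pre_map =
  darts :: "'d set"
  ccw :: "'d \<Rightarrow> 'd"
  opp :: "'d \<Rightarrow> 'd"
  root_dart :: 'd

definition vertex_of :: "'d pre_map \<Rightarrow> 'd \<Rightarrow> 'd set" where
  "vertex_of M d = orbit (ccw M) d"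

definition edge_of :: "'d pre_map \<Rightarrow> 'd \<Rightarrow> 'd set" where
  "edge_of M d = {d, opp M d}"

(* The next side along the face containing the side d: traverse the edge of d, then turn
   to the next half-edge around the vertex reached. *)
definition face_perm :: "'d pre_map \<Rightarrow> 'd \<Rightarrow> 'd" where
  "face_perm M = ccw M \<circ> opp M"

definition face_of :: "'d pre_map \<Rightarrow> 'd \<Rightarrow> 'd set" where
  "face_of M d = orbit (face_perm M) d"

definition vertices :: "'d pre_map \<Rightarrow> 'd set set" where
  "vertices M = vertex_of M ` darts M"

definition edges :: "'d pre_map \<Rightarrow> 'd set set" where
  "edges M = edge_of M ` darts M"

definition faces :: "'d pre_map \<Rightarrow> 'd set set" where
  "faces M = face_of M ` darts M"

(* Connectedness of the graph with vertex set "vertices M" and edge set T. *)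
definition connected_by :: "'d pre_map \<Rightarrow> 'd set set \<Rightarrow> bool" where
  "connected_by M T \<longleftrightarrow> (\<forall>u\<in>vertices M. \<forall>v\<in>vertices M.
     (u, v) \<in> {(vertex_of M d, vertex_of M (opp M d)) | d. d \<in> darts M \<and> edge_of M d \<in> T}\<^sup>*)"

(* A cycle is given by the successive darts traversed; its vertices are distinct and so are
   its edges.  Loops are cycles of length 1, pairs of parallel edges cycles of length 2. *)
definition is_cycle :: "'d pre_map \<Rightarrow> 'd set set \<Rightarrow> 'd list \<Rightarrow> bool" where
  "is_cycle M T ds \<longleftrightarrow> ds \<noteq> [] \<and> set ds \<subseteq> darts M \<and> edge_of M ` set ds \<subseteq> T \<and>
     (\<forall>i<length ds. vertex_of M (opp M (ds ! i)) = vertex_of M (ds ! (Suc i mod length ds))) \<and>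
     distinct (map (vertex_of M) ds) \<and> distinct (map (edge_of M) ds)"

definition spanning_tree :: "'d pre_map \<Rightarrow> 'd set set \<Rightarrow> bool" where
  "spanning_tree M T \<longleftrightarrow> T \<subseteq> edges M \<and> connected_by M T \<and> (\<nexists>ds. is_cycle M T ds)"

(* The root dart excludes the map without edges, so a rooted map has at least one edge. *)
definition rooted_map :: "'d pre_map \<Rightarrow> bool" where
  "rooted_map M \<longleftrightarrow> finite (darts M) \<and> ccw M permutes darts M \<and> opp M permutes darts M \<and>
     (\<forall>d\<in>darts M. opp M d \<noteq> d \<and> opp M (opp M d) = d) \<and>
     root_dart M \<in> darts M \<and> connected_by M (edges M)"

definition unicellular :: "'d pre_map \<Rightarrow> bool" where
  "unicellular M \<longleftrightarrow> card (faces M) = 1"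

definition map_iso :: "('d \<Rightarrow> 'e) \<Rightarrow> 'd pre_map \<Rightarrow> 'e pre_map \<Rightarrow> bool" where
  "map_iso f M N \<longleftrightarrow> bij_betw f (darts M) (darts N) \<and>
     (\<forall>d\<in>darts M. f (ccw M d) = ccw N (f d) \<and> f (opp M d) = opp N (f d)) \<and>
     f (root_dart M) = root_dart N"

(* Vertex labels, used both for colors and for vertex names; only the values on "vertices M"
   matter. *)
type_synonym 'd labelled = "'d pre_map \<times> ('d set \<Rightarrow> nat)"

fun labelled_iso :: "('d \<Rightarrow> 'e) \<Rightarrow> 'd labelled \<Rightarrow> 'e labelled \<Rightarrow> bool" where
  "labelled_iso f (M, c) (N, c') \<longleftrightarrow> map_iso f M N \<and> (\<forall>v\<in>vertices M. c' (f ` v) = c v)"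

definition edge_count :: "'d pre_map \<Rightarrow> ('d set \<Rightarrow> nat) \<Rightarrow> nat \<Rightarrow> nat \<Rightarrow> nat" where
  "edge_count M c i j = card {e \<in> edges M. (\<lambda>d. c (vertex_of M d)) ` e = {i, j}}"

(* Concrete maps with dart set a finite set of natural numbers represent all isomorphism
   classes; maps proper are the classes. *)
definition pre_colored_unicellular :: "nat \<Rightarrow> nat \<Rightarrow> nat labelled set" where
  "pre_colored_unicellular n q = {(M, c). rooted_map M \<and> unicellular M \<and> card (edges M) = n \<and>
     c ` vertices M = {1..q}}"

definition colored_iso_rel :: "nat \<Rightarrow> nat \<Rightarrow> nat labelled rel" where
  "colored_iso_rel n q = {(X, Y). X \<in> pre_colored_unicellular n q \<and>
     Y \<in> pre_colored_unicellular n q \<and> (\<exists>f. labelled_iso f X Y)}"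

definition colored_unicellular_maps :: "nat \<Rightarrow> nat \<Rightarrow> nat labelled set set" where
  "colored_unicellular_maps n q = pre_colored_unicellular n q // colored_iso_rel n q"

type_synonym 'd tree_labelled = "'d labelled \<times> 'd set set"

definition pre_tree_rooted :: "nat \<Rightarrow> nat \<Rightarrow> nat tree_labelled set" where
  "pre_tree_rooted n q = {((M, l), T). rooted_map M \<and> card (edges M) = n \<and>
     bij_betw l (vertices M) {1..q} \<and> spanning_tree M T}"

definition tree_iso_rel :: "nat \<Rightarrow> nat \<Rightarrow> nat tree_labelled rel" where
  "tree_iso_rel n q = {((X, S), (Y, T)). (X, S) \<in> pre_tree_rooted n q \<and>
     (Y, T) \<in> pre_tree_rooted n q \<and> (\<exists>f. labelled_iso f X Y \<and> (\<lambda>e. f ` e) ` S = T)}"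

definition tree_rooted_maps :: "nat \<Rightarrow> nat \<Rightarrow> nat tree_labelled set set" where
  "tree_rooted_maps n q = pre_tree_rooted n q // tree_iso_rel n q"

lemma rooted_map_closed:
  assumes "rooted_map M" "d \<in> darts M"
  shows "ccw M d \<in> darts M" "opp M d \<in> darts M" "vertex_of M d \<subseteq> darts M"
proof -
  show c: "ccw M d \<in> darts M" and "opp M d \<in> darts M"
    using assms by (auto simp: rooted_map_def permutes_in_image)
  have "x \<in> darts M" if "x \<in> orbit (ccw M) d" for x
    using that by induction (use assms in \<open>auto simp: rooted_map_def permutes_in_image\<close>)
  then show "vertex_of M d \<subseteq> darts M" by (auto simp: vertex_of_def)
qed

lemma map_iso_vertex_of:
  assumes "rooted_map M" "map_iso f M N" "d \<in> darts M"
  shows "f ` vertex_of M d = vertex_of N (f d)"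
proof -
  have comm: "f (ccw M x) = ccw N (f x)" if "x \<in> darts M" for x
    using assms(2) that by (auto simp: map_iso_def)
  have sub: "orbit (ccw M) d \<subseteq> darts M"
    using rooted_map_closed(3)[OF assms(1,3)] by (simp add: vertex_of_def)
  have "f x \<in> orbit (ccw N) (f d)" if "x \<in> orbit (ccw M) d" for x
    using that
  proof induction
    case base
    show ?case by (simp add: comm[OF assms(3)] orbit.base)
  next
    case (step y)
    then have "f (ccw M y) = ccw N (f y)" using comm sub by auto
    then show ?case using orbit.step[OF step.IH] by simp
  qed
  moreover have "y \<in> f ` orbit (ccw M) d" if "y \<in> orbit (ccw N) (f d)" for y
    using that
  proof induction
    case base
    show ?case by (rule image_eqI[of _ _ "ccw M d"]) (auto simp: comm assms(3) orbit.base)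
  next
    case (step y)
    then obtain x where x: "x \<in> orbit (ccw M) d" "y = f x" by auto
    then have "ccw N y = f (ccw M x)" using comm sub by auto
    then show ?case using x by (auto intro: orbit.step)
  qed
  ultimately show ?thesis by (auto simp: vertex_of_def)
qed

lemma map_iso_vertices:
  assumes "rooted_map M" "map_iso f M N" "v \<in> vertices M"
  shows "f ` v \<in> vertices N"
proof -
  obtain d where d: "d \<in> darts M" "v = vertex_of M d" using assms(3) by (auto simp: vertices_def)
  have "f d \<in> darts N" using assms(2) d(1) by (auto simp: map_iso_def bij_betw_apply)
  then show ?thesis using map_iso_vertex_of[OF assms(1,2) d(1)] d by (auto simp: vertices_def)
qed

lemma labelled_iso_id: "labelled_iso (\<lambda>d. d) X X"
  by (cases X) (auto simp: map_iso_def bij_betw_def)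

lemma labelled_iso_comp:
  assumes "rooted_map (fst X)" "labelled_iso f X Y" "labelled_iso g Y Z"
  shows "labelled_iso (g \<circ> f) X Z"
proof -
  obtain M c N c' P c'' where [simp]: "X = (M, c)" "Y = (N, c')" "Z = (P, c'')"
    by (metis surj_pair)
  have f: "map_iso f M N" "map_iso g N P" using assms by auto
  then have "map_iso (g \<circ> f) M P"
    by (auto simp: map_iso_def bij_betw_apply intro: bij_betw_trans)
  moreover have "c'' ((g \<circ> f) ` v) = c v" if "v \<in> vertices M" for v
    using map_iso_vertices[OF _ f(1) that] that assms by (auto simp: image_comp[symmetric] simp del: comp_apply)
  ultimately show ?thesis by simp
qed

lemma labelled_iso_inv:
  assumes "rooted_map (fst X)" "rooted_map (fst Y)" "labelled_iso f X Y"
  defines "g \<equiv> inv_into (darts (fst X)) f"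
  shows "labelled_iso g Y X"
proof -
  obtain M c N c' where [simp]: "X = (M, c)" "Y = (N, c')" by (metis surj_pair)
  have M: "rooted_map M" and N: "rooted_map N" and f: "map_iso f M N"
    and c: "\<And>v. v \<in> vertices M \<Longrightarrow> c' (f ` v) = c v" using assms by auto
  have b: "bij_betw f (darts M) (darts N)" using f by (simp add: map_iso_def)
  have gf: "g (f x) = x" if "x \<in> darts M" for x
    using b that by (simp add: g_def bij_betw_inv_into_left)
  have fsurj: "\<exists>x\<in>darts M. y = f x" if "y \<in> darts N" for y
    using b that by (auto simp: bij_betw_def)
  have g: "map_iso g N M"
    unfolding map_iso_def
  proof (intro conjI ballI)
    show "bij_betw g (darts N) (darts M)" using b by (simp add: g_def bij_betw_inv_into)
    show "g (root_dart N) = root_dart M"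
      using f M gf[of "root_dart M"] by (auto simp: map_iso_def rooted_map_def)
  next
    fix y assume "y \<in> darts N"
    then obtain x where x: "x \<in> darts M" "y = f x" using fsurj by blast
    have "ccw N y = f (ccw M x)" "opp N y = f (opp M x)"
      using f x by (auto simp: map_iso_def)
    then show "g (ccw N y) = ccw M (g y)" "g (opp N y) = opp M (g y)"
      using gf rooted_map_closed[OF M x(1)] x by auto
  qed
  have "c (g ` w) = c' w" if w: "w \<in> vertices N" for w
  proof -
    obtain x where x: "x \<in> darts M" "w = vertex_of N (f x)"
      using w fsurj by (auto simp: vertices_def)
    have w': "w = f ` vertex_of M x" using map_iso_vertex_of[OF M f x(1)] x by simp
    have "g ` w = vertex_of M x"
      unfolding w' image_image using rooted_map_closed(3)[OF M x(1)] gf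
      by (auto simp: image_iff subset_iff)
    then show ?thesis using w' c x(1) by (auto simp: vertices_def)
  qed
  then show ?thesis using g by simp
qed

lemma equiv_colored_iso_rel: "equiv (pre_colored_unicellular n q) (colored_iso_rel n q)"
proof (rule equivI)
  have r: "rooted_map (fst X)" if "X \<in> pre_colored_unicellular n q" for X
    using that by (auto simp: pre_colored_unicellular_def)
  show "colored_iso_rel n q \<subseteq> pre_colored_unicellular n q \<times> pre_colored_unicellular n q"
    by (auto simp: colored_iso_rel_def)
  show "refl_on (pre_colored_unicellular n q) (colored_iso_rel n q)"
    using labelled_iso_id by (fastforce simp: refl_on_def colored_iso_rel_def)
  show "sym (colored_iso_rel n q)"
    unfolding sym_def colored_iso_rel_def using labelled_iso_inv[OF r r] by blast
  show "trans (colored_iso_rel n q)"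
    unfolding trans_def colored_iso_rel_def using labelled_iso_comp[OF r] by blast
qed

lemma equiv_tree_iso_rel: "equiv (pre_tree_rooted n q) (tree_iso_rel n q)"
proof (rule equivI)
  have r: "rooted_map (fst X)" "S \<subseteq> edges (fst X)" if "(X, S) \<in> pre_tree_rooted n q" for X S
    using that by (auto simp: pre_tree_rooted_def spanning_tree_def)
  show "tree_iso_rel n q \<subseteq> pre_tree_rooted n q \<times> pre_tree_rooted n q"
    by (auto simp: tree_iso_rel_def)
  show "refl_on (pre_tree_rooted n q) (tree_iso_rel n q)"
    unfolding refl_on_def tree_iso_rel_def using labelled_iso_id by (auto intro!: exI[of _ "\<lambda>d. d"])
  show "sym (tree_iso_rel n q)"
  proof (rule symI)
    fix A B assume "(A, B) \<in> tree_iso_rel n q"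
    then obtain X S Y T f where AB: "A = (X, S)" "B = (Y, T)"
      and X: "(X, S) \<in> pre_tree_rooted n q" and Y: "(Y, T) \<in> pre_tree_rooted n q"
      and f: "labelled_iso f X Y" and T: "(\<lambda>e. f ` e) ` S = T"
      by (auto simp: tree_iso_rel_def)
    define g where "g = inv_into (darts (fst X)) f"
    have inj: "inj_on f (darts (fst X))"
      using f by (cases X, cases Y) (auto simp: map_iso_def bij_betw_def)
    have "g ` f ` e = e" if "e \<in> S" for e
    proof -
      have "e \<subseteq> darts (fst X)"
        using r(2)[OF X] that rooted_map_closed(2)[OF r(1)[OF X]]
        by (auto simp: edges_def edge_of_def)
      then show ?thesis unfolding g_def using inj by (rule inv_into_image_cancel[rotated])
    qed
    then have "(\<lambda>e. g ` e) ` T = S" using T by (auto simp: image_image)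
    then show "(B, A) \<in> tree_iso_rel n q"
      using labelled_iso_inv[OF r(1)[OF X] r(1)[OF Y] f] X Y AB
      by (auto simp: tree_iso_rel_def g_def)
  qed
  show "trans (tree_iso_rel n q)"
  proof (rule transI)
    fix A B C assume "(A, B) \<in> tree_iso_rel n q" "(B, C) \<in> tree_iso_rel n q"
    then obtain X S Y T Z U f g where *: "A = (X, S)" "B = (Y, T)" "C = (Z, U)"
      and X: "(X, S) \<in> pre_tree_rooted n q" and Z: "(Z, U) \<in> pre_tree_rooted n q"
      and f: "labelled_iso f X Y" "(\<lambda>e. f ` e) ` S = T"
      and g: "labelled_iso g Y Z" "(\<lambda>e. g ` e) ` T = U"
      by (auto simp: tree_iso_rel_def)
    have "(\<lambda>e. (g \<circ> f) ` e) ` S = U" using f g by (auto simp: image_image image_comp)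
    then show "(A, C) \<in> tree_iso_rel n q"
      using labelled_iso_comp[OF r(1)[OF X] f(1) g(1)] X Z * by (auto simp: tree_iso_rel_def)
  qed
qed

end

theory Submission
  imports Defs "HOL-Combinatorics.Cycles" "HOL-Library.Sublist"
begin

text \<open>
  The bijection comes from the BEST theorem on Eulerian tours. Both kinds of map are read on the
  same darts, with the same edge involution, the same root dart and the same labels of the darts.
  View each dart as an arc from its own label to the label of the opposite dart. A colored
  unicellular map is then nothing but an Eulerian tour of the resulting digraph that starts with
  the root dart: the tour is the list of darts along the unique face. Indeed the next dart along the
  face sits at the vertex just reached, so a labelling of the darts is constant on vertices exactly
  if each dart on the face carries the label to which the previous dart leads.

  Such a tour leaves each label along all its darts, in a certain order. Closing this order up to a
  cycle, for each label separately, merges all vertices of one color into a single vertex and gives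
  the rotation system of a map with vertex set \<open>{1..q}\<close>. The edges by which the tour leaves each
  label for the last time, except for the label of the root dart, form a spanning tree: after the
  last exit from a label, the tour moves to a label whose last exit comes later, or to the label of
  the root dart, where it ends. This is \<open>tour_exit_orders\<close>.

  Conversely, a rotation system with a spanning tree determines the order of the darts at each
  label: at the root vertex start with the root dart; elsewhere start right after the tree edge
  that leads towards the root, so that this edge comes last. Walking greedily, that is, always
  leaving along the first unused dart, can only stop at the root label, and then every dart has been
  used: \<open>exit_orders_tour\<close>.

  The maps are isomorphism classes, so besides the two existence results the correspondence must
  preserve and reflect isomorphism (\<open>corresponds_labelled_iso\<close>). It does because a tour is determined
  by the orders of its exits (\<open>tour_eqI\<close>), and these are determined by the rotation, the tree and the
  root (\<open>parent_darts_unique\<close>). No edge or label of a dart has changed, hence the statement on edge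
  counts.
\<close>

section \<open>Cycles of permutations as lists\<close>

text \<open>A cycle of a permutation, cut open at a chosen element. Compared with orbits, which are sets,
  lists keep the starting point, as both a rooted face and the exits of a tour require.\<close>
definition cyclic_list :: "('a \<Rightarrow> 'a) \<Rightarrow> 'a list \<Rightarrow> bool" where
  "cyclic_list g xs \<longleftrightarrow> distinct xs \<and> xs \<noteq> [] \<and> map g xs = rotate1 xs"

definition orbit_list :: "('a \<Rightarrow> 'a) \<Rightarrow> 'a \<Rightarrow> 'a list" where
  "orbit_list g x = map (\<lambda>i. (g ^^ i) x) [0..<card (orbit g x)]"

lemma cyclic_list_nth:
  assumes "cyclic_list g xs" "i < length xs"
  shows "g (xs ! i) = xs ! (Suc i mod length xs)"
  using assms by (metis cyclic_list_def nth_map nth_rotate1)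

lemma cyclic_list_funpow:
  assumes "cyclic_list g xs"
  shows "(g ^^ k) (hd xs) = xs ! (k mod length xs)"
proof (induction k)
  case 0
  then show ?case using assms by (simp add: cyclic_list_def hd_conv_nth)
next
  case (Suc k)
  have "k mod length xs < length xs" using assms by (simp add: cyclic_list_def)
  then show ?case using Suc cyclic_list_nth[OF assms] by (simp add: mod_Suc_eq)
qed

text \<open>The powers of \<open>g\<close> at the head run through the entries in order, so that the orbit of the head is
  the whole list; that the choice of the element is immaterial is the general fact that a cyclic
  set is the orbit of each of its elements.\<close>
lemma cyclic_list_orbit:
  assumes "cyclic_list g xs" "x \<in> set xs"
  shows "orbit g x = set xs"
proof -
  have ne: "0 < length xs" using assms by (simp add: cyclic_list_def)
  have "orbit g (hd xs) = set xs"
  proof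
    show "orbit g (hd xs) \<subseteq> set xs"
      using ne by (auto simp: orbit_altdef cyclic_list_funpow[OF assms(1)])
    have "xs ! i \<in> orbit g (hd xs)" if "i < length xs" for i
    proof -
      have "xs ! i = (g ^^ (i + length xs)) (hd xs)"
        using that by (subst cyclic_list_funpow[OF assms(1)]) simp
      moreover have "0 < i + length xs" using ne by simp
      ultimately show ?thesis unfolding orbit_altdef by blast
    qed
    then show "set xs \<subseteq> orbit g (hd xs)" by (auto simp: in_set_conv_nth)
  qed
  moreover have "hd xs \<in> set xs" using assms by (simp add: cyclic_list_def)
  ultimately have "cyclic_on g (set xs)" by (auto simp: cyclic_on_def)
  then show ?thesis using assms(2) by (simp add: orbit_cyclic_eq3)
qed

text \<open>A cyclic list is determined by the permutation and its head. This is how equality of faces and of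
  exit orders is proved below.\<close>
lemma orbit_list_cyclic_list:
  assumes "cyclic_list g xs"
  shows "orbit_list g (hd xs) = xs"
proof -
  have "hd xs \<in> set xs" "card (set xs) = length xs"
    using assms by (auto simp: cyclic_list_def distinct_card)
  then show ?thesis
    by (intro nth_equalityI)
      (simp_all add: orbit_list_def cyclic_list_orbit[OF assms] cyclic_list_funpow[OF assms])
qed

lemma cyclic_list_orbit_list:
  assumes "g permutes S" "finite S"
  shows "cyclic_list g (orbit_list g x)" and "set (orbit_list g x) = orbit g x"
    and "hd (orbit_list g x) = x"
proof -
  define m where "m = funpow_dist1 g x x"
  have x: "x \<in> orbit g x"
    using assms by (metis permutation_permutes permutation_self_in_orbit)
  have m: "inj_on (\<lambda>i. (g ^^ i) x) {0..<m}" "orbit g x = (\<lambda>i. (g ^^ i) x) ` {0..<m}"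
    "(g ^^ m) x = x" "0 < m"
    using inj_on_funpow_dist1[OF x] orbit_conv_funpow_dist1[OF x] funpow_dist1_prop[OF x]
    by (simp_all add: m_def)
  have card: "card (orbit g x) = m" unfolding m(2) by (simp add: card_image[OF m(1)])
  have ol: "orbit_list g x = map (\<lambda>i. (g ^^ i) x) [0..<m]" by (simp add: orbit_list_def card)
  show "set (orbit_list g x) = orbit g x" by (simp add: ol m(2))
  show hd: "hd (orbit_list g x) = x" using m(4) by (simp add: ol hd_map)
  have "map g (orbit_list g x) = rotate1 (orbit_list g x)"
  proof (rule nth_equalityI)
    fix i assume "i < length (map g (orbit_list g x))"
    then have i: "i < m" by (simp add: ol)
    then consider "Suc i < m" | "Suc i = m" by linarith
    then show "map g (orbit_list g x) ! i = rotate1 (orbit_list g x) ! i"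
      using i m(3,4) by cases (auto simp: ol nth_rotate1 simp flip: funpow.simps(2) o_apply[of g])
  qed simp
  then show "cyclic_list g (orbit_list g x)"
    using m(1,4) by (simp add: cyclic_list_def ol distinct_map)
qed

lemma cyclic_list_cycle_of_list:
  assumes "distinct xs" "xs \<noteq> []"
  shows "cyclic_list (cycle_of_list xs) xs"
  using cyclic_rotation[OF assms(1), of 1] assms by (simp add: cyclic_list_def)

lemma cyclic_list_map:
  assumes "cyclic_list g xs" "inj_on f (set xs)" "\<And>x. x \<in> set xs \<Longrightarrow> f (g x) = g' (f x)"
  shows "cyclic_list g' (map f xs)"
proof -
  have "map g' (map f xs) = map f (map g xs)" using assms(3) by simp
  also have "\<dots> = rotate1 (map f xs)" using assms(1) by (simp add: cyclic_list_def rotate1_map)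
  finally show ?thesis using assms by (simp add: cyclic_list_def distinct_map)
qed

text \<open>The converse of \<open>cyclic_list_map\<close>: mapping one cycle onto another, starting points included,
  already forces \<open>f\<close> to intertwine the two permutations.\<close>
lemma cyclic_list_commute:
  assumes "cyclic_list g xs" "cyclic_list g' (map f xs)" "x \<in> set xs"
  shows "f (g x) = g' (f x)"
proof -
  have "map f (map g xs) = map g' (map f xs)"
    using assms by (simp add: cyclic_list_def rotate1_map)
  then show ?thesis using assms(3) by simp
qed

lemma cyclic_list_last:
  assumes "cyclic_list g xs"
  shows "g (last xs) = hd xs"
proof -
  have "g (last xs) = last (map g xs)" using assms last_map[of xs g] by (simp add: cyclic_list_def)
  also have "\<dots> = last (rotate1 xs)" using assms by (simp add: cyclic_list_def)
  also have "\<dots> = hd xs" using assms by (cases xs) (auto simp: cyclic_list_def)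
  finally show ?thesis .
qed

lemma cyclic_list_image:
  assumes "cyclic_list g xs"
  shows "g ` set xs = set xs"
  using assms by (metis cyclic_list_def list.set_map set_rotate1)

section \<open>Eulerian tours and directed trees\<close>

text \<open>The digraph of the BEST theorem: the dart \<open>d\<close> is an arc from \<open>col d\<close> to \<open>col (flip d)\<close>. Since \<open>flip\<close>
  exchanges arcs into and out of a label, in-degrees equal out-degrees. The type of labels is
  arbitrary because the labels are the vertices of a map (to treat spanning trees), the colors of
  its vertices, or their names.\<close>
locale dart_graph =
  fixes D :: "'d set" and flip :: "'d \<Rightarrow> 'd" and col :: "'d \<Rightarrow> 'v" and r :: 'd
  assumes fin: "finite D"
    and flip_in: "d \<in> D \<Longrightarrow> flip d \<in> D"
    and flip_neq: "d \<in> D \<Longrightarrow> flip d \<noteq> d"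
    and flip_flip: "d \<in> D \<Longrightarrow> flip (flip d) = d"
    and r_in: "r \<in> D"
begin

definition exits :: "'d list \<Rightarrow> 'v \<Rightarrow> 'd list" where
  "exits ts v = filter (\<lambda>d. col d = v) ts"

definition walk :: "'d list \<Rightarrow> bool" where
  "walk ts \<longleftrightarrow> successively (\<lambda>d e. col (flip d) = col e) ts"

definition tour :: "'d list \<Rightarrow> bool" where
  "tour ts \<longleftrightarrow> distinct ts \<and> set ts = D \<and> hd ts = r \<and> walk ts \<and> col (flip (last ts)) = col r"

definition others :: "'v set" where
  "others = col ` D - {col r}"

text \<open>A tree directed towards the label of \<open>r\<close>, given by the dart with which the path to the root starts.
  The rank excludes directed cycles; any function that decreases along the darts will do, be it the
  distance to the root or the time that remains after the last exit of a tour.\<close>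
definition parent_darts :: "('v \<Rightarrow> 'd) \<Rightarrow> bool" where
  "parent_darts p \<longleftrightarrow> (\<forall>v\<in>others. p v \<in> D \<and> col (p v) = v) \<and>
     (\<exists>rank :: 'v \<Rightarrow> nat. \<forall>v\<in>others. rank (col (flip (p v))) < rank v)"

text \<open>The data on the tree side of the BEST theorem: an order of the darts at each label, whose last
  darts form a tree directed to the root.\<close>
definition exit_orders :: "('v \<Rightarrow> 'd list) \<Rightarrow> bool" where
  "exit_orders w \<longleftrightarrow> (\<forall>v\<in>col ` D. distinct (w v) \<and> set (w v) = {d \<in> D. col d = v}) \<and>
     hd (w (col r)) = r \<and> parent_darts (\<lambda>v. last (w v))"

definition tree_edges :: "('v \<Rightarrow> 'd) \<Rightarrow> 'd set set" where
  "tree_edges p = (\<lambda>v. {p v, flip (p v)}) ` others"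

lemma tour_nonempty: "tour ts \<Longrightarrow> ts \<noteq> []"
  using r_in by (auto simp: tour_def)

text \<open>The rank of a label other than the root is the number of steps of the tour from its last exit on. If the label is left
  for the last time along \<open>x\<close>, and \<open>y\<close> is the next dart, then the label of \<open>y\<close> has an exit strictly
  after \<open>x\<close>. If there is no next dart, \<open>x\<close> leads to the root, which has rank \<open>0\<close>.\<close>
lemma tour_exit_orders:
  assumes ts: "tour ts"
  shows "exit_orders (exits ts)"
proof -
  define rank where "rank v = (if v = col r then 0
    else Suc (length (takeWhile (\<lambda>d. col d \<noteq> v) (rev ts))))" for v
  have ne: "ts \<noteq> []" using tour_nonempty[OF ts] .
  have set: "set (exits ts v) = {d \<in> D. col d = v}" for v
    using ts by (auto simp: exits_def tour_def)
  have "last (exits ts v) \<in> D \<and> col (last (exits ts v)) = v" if "v \<in> others" for v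
  proof -
    have "exits ts v \<noteq> []" using set[of v] that by (auto simp: others_def)
    then show ?thesis using set[of v] last_in_set by blast
  qed
  moreover have "rank (col (flip (last (exits ts v)))) < rank v" if v: "v \<in> others" for v
  proof -
    have "\<exists>x\<in>set ts. col x = v" using ts v by (auto simp: tour_def others_def)
    then obtain ys x zs where split: "ts = ys @ x # zs" "col x = v" "\<forall>z\<in>set zs. col z \<noteq> v"
      using split_list_last_prop[of ts "\<lambda>d. col d = v"] by blast
    have "filter (\<lambda>d. col d = v) zs = []" using split(3) by (simp add: filter_empty_conv)
    then have last: "last (exits ts v) = x"
      unfolding exits_def split(1) using split(2) by simp
    have "takeWhile (\<lambda>d. col d \<noteq> v) (rev ts) = rev zs"
      unfolding split(1) using split(2,3) takeWhile_append2[of "rev zs" "\<lambda>d. col d \<noteq> v"] by simp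
    then have rank_v: "rank v = Suc (length zs)" using v by (simp add: rank_def others_def)
    show ?thesis
    proof (cases zs)
      case Nil
      then have "col (flip x) = col r" using ts split(1) by (simp add: tour_def)
      then show ?thesis using last rank_v by (simp add: rank_def)
    next
      case (Cons y zs')
      have "walk (ys @ x # y # zs')" using ts split(1) Cons by (simp add: tour_def)
      then have y: "col (flip x) = col y" by (auto simp: walk_def successively_append_iff)
      have "takeWhile (\<lambda>d. col d \<noteq> col y) (rev ts) = takeWhile (\<lambda>d. col d \<noteq> col y) (rev zs)"
        using takeWhile_append1[of y "rev zs" "\<lambda>d. col d \<noteq> col y" "x # rev ys"] split(1) Cons by simp
      moreover have "length (takeWhile (\<lambda>d. col d \<noteq> col y) (rev zs)) < length (rev zs)"
        using takeWhile_dropWhile_id[of "\<lambda>d. col d \<noteq> col y" "rev zs"]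
          dropWhile_eq_Nil_conv[of "\<lambda>d. col d \<noteq> col y" "rev zs"]
        by (metis Cons append.right_neutral length_takeWhile_le list.set_intros(1) nat_less_le
            set_rev append_eq_append_conv)
      ultimately show ?thesis using last rank_v y by (simp add: rank_def)
    qed
  qed
  ultimately have "parent_darts (\<lambda>v. last (exits ts v))" unfolding parent_darts_def by blast
  moreover have "hd (exits ts (col r)) = r"
    using ts ne by (cases ts) (auto simp: exits_def tour_def)
  ultimately show ?thesis using ts set by (auto simp: exit_orders_def exits_def tour_def)
qed

text \<open>Given the order of the exits at each label, there is never a choice: the label reached determines
  the next dart. The induction removes the first dart from both walks.\<close>
lemma walk_eqI:
  assumes "walk xs" "walk ys" "\<And>v. exits xs v = exits ys v"
    and "xs \<noteq> [] \<Longrightarrow> ys \<noteq> [] \<Longrightarrow> col (hd xs) = col (hd ys)"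
  shows "xs = ys"
  using assms
proof (induction xs arbitrary: ys)
  case Nil
  have "ys = []"
  proof (rule ccontr)
    assume "ys \<noteq> []"
    then have "exits ys (col (hd ys)) \<noteq> []" by (cases ys) (auto simp: exits_def)
    then show False using Nil(3)[of "col (hd ys)"] by (simp add: exits_def)
  qed
  then show ?case by simp
next
  case (Cons x xs)
  have "ys \<noteq> []" using Cons(4)[of "col x"] by (auto simp: exits_def)
  then obtain y ys' where ys: "ys = y # ys'" by (cases ys) auto
  have col: "col x = col y" using Cons(5) ys by simp
  have xy: "x = y" using Cons(4)[of "col x"] col by (simp add: exits_def ys)
  have "exits xs v = exits ys' v" for v
    using Cons(4)[of v] xy by (auto simp: exits_def ys split: if_splits)
  moreover have "walk xs" "walk ys'" using Cons(2,3) by (auto simp: walk_def ys successively_Cons)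
  moreover have "xs \<noteq> [] \<Longrightarrow> ys' \<noteq> [] \<Longrightarrow> col (hd xs) = col (hd ys')"
    using Cons(2,3) xy by (auto simp: walk_def ys successively_Cons)
  ultimately have "xs = ys'" using Cons(1) by blast
  then show ?case using xy ys by simp
qed

lemma tour_eqI:
  assumes "tour ts" "tour ts'" "\<And>v. v \<in> col ` D \<Longrightarrow> exits ts v = exits ts' v"
  shows "ts = ts'"
proof (rule walk_eqI)
  show "exits ts v = exits ts' v" for v
  proof (cases "v \<in> col ` D")
    case False
    then have "exits ts v = []" "exits ts' v = []"
      using assms(1,2) by (auto simp: exits_def tour_def filter_empty_conv)
    then show ?thesis by simp
  qed (rule assms(3))
qed (use assms in \<open>auto simp: tour_def\<close>)

text \<open>Each dart but the last enters the label that its successor leaves, so that the two counts differ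
  only through the ends of the walk.\<close>
lemma walk_balance:
  assumes "walk ts" "ts \<noteq> []"
  shows "length (filter (\<lambda>d. col (flip d) = v) ts) + (if col (hd ts) = v then 1 else 0) =
    length (exits ts v) + (if col (flip (last ts)) = v then 1 else (0::nat))"
  using assms
proof (induction ts)
  case (Cons x xs)
  show ?case
  proof (cases xs)
    case (Cons y ys)
    then have "walk xs" "col (flip x) = col y" using Cons.prems by (auto simp: walk_def)
    then show ?thesis using Cons.IH Cons by (auto simp: exits_def split: if_splits)
  qed (auto simp: exits_def)
qed simp

lemma card_entries:
  "card {d \<in> D. col (flip d) = v} = card {d \<in> D. col d = v}"
proof (rule bij_betw_same_card)
  show "bij_betw flip {d \<in> D. col (flip d) = v} {d \<in> D. col d = v}"
    by (rule bij_betw_byWitness[where f' = flip]) (auto simp: flip_in flip_flip)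
qed

text \<open>The walk is built greedily: \<open>legal\<close> walks use the darts at each label in the given order, and a
  legal walk of maximal length is shown to be a tour. By maximality all darts at its final label \<open>u\<close>
  are used up; were \<open>u\<close> not the root label, it would have been entered once more often than it
  can be. So the walk is closed and leaves each label as often as it enters it. Now all darts at a
  label \<open>v\<close> are used, by induction on the rank of \<open>v\<close>: the parent of \<open>v\<close> has all its exits used, hence
  all its entries, among them the last dart at \<open>v\<close>; and this one is used only after all the others.\<close>
lemma exit_orders_tour:
  assumes w: "exit_orders w"
  shows "\<exists>ts. tour ts \<and> (\<forall>v\<in>col ` D. exits ts v = w v)"
proof -
  have wd: "distinct (w v)" "set (w v) = {d \<in> D. col d = v}" if "v \<in> col ` D" for v
    using w that by (auto simp: exit_orders_def)
  have hd: "hd (w (col r)) = r" using w by (simp add: exit_orders_def)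
  have wr: "w (col r) = r # tl (w (col r))"
  proof -
    have "w (col r) \<noteq> []" using wd(2)[of "col r"] r_in by auto
    then show ?thesis using hd by (metis list.collapse)
  qed
  define legal where "legal ts \<longleftrightarrow> ts \<noteq> [] \<and> hd ts = r \<and> set ts \<subseteq> D \<and> walk ts \<and>
    (\<forall>v\<in>col ` D. prefix (exits ts v) (w v))" for ts
  have legal_distinct: "distinct ts" if "legal ts" for ts
  proof (rule ccontr)
    assume "\<not> distinct ts"
    then obtain xs ys zs x where ts: "ts = xs @ x # ys @ x # zs"
      by (metis append_Cons append_Nil append_assoc not_distinct_decomp)
    have "col x \<in> col ` D" using that ts by (auto simp: legal_def)
    then have "prefix (exits ts (col x)) (w (col x))" "distinct (w (col x))"
      using that wd(1) unfolding legal_def by blast+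
    then have "distinct (exits ts (col x))" by (auto simp: prefix_def)
    then show False by (simp add: exits_def ts)
  qed
  have "legal [r]"
  proof -
    have "prefix (exits [r] v) (w v)" for v
      using wr by (auto simp: exits_def) (metis Cons_prefix_Cons Nil_prefix)
    then show ?thesis using r_in by (auto simp: legal_def walk_def)
  qed
  moreover have "length ts < Suc (card D)" if "legal ts" for ts
    using legal_distinct[OF that] that fin card_mono[of D "set ts"]
    by (simp add: legal_def distinct_card)
  ultimately obtain ts where ts: "legal ts" and max: "\<And>ts'. legal ts' \<Longrightarrow> length ts' \<le> length ts"
    using ex_has_greatest_nat[of legal "[r]" length "Suc (card D)"] by auto
  have d: "distinct ts" "set ts \<subseteq> D" "ts \<noteq> []" "hd ts = r" "walk ts"
    and pre: "\<And>v. v \<in> col ` D \<Longrightarrow> prefix (exits ts v) (w v)"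
    using ts legal_distinct by (auto simp: legal_def)
  define u where "u = col (flip (last ts))"
  have u_in: "u \<in> col ` D" unfolding u_def using d flip_in by (simp add: subset_iff)
  \<comment> \<open>Otherwise the next dart in the order at \<open>u\<close> would prolong the walk.\<close>
  have full_u: "exits ts u = w u"
  proof (rule ccontr)
    assume "exits ts u \<noteq> w u"
    then obtain x zs where x: "w u = exits ts u @ x # zs"
      using pre[OF u_in] by (metis append_Nil2 list.exhaust prefix_def)
    have xD: "x \<in> D" "col x = u" using wd(2)[OF u_in] x by auto
    have "prefix (exits (ts @ [x]) v) (w v)" if "v \<in> col ` D" for v
      using pre[OF that] x xD by (auto simp: exits_def)
    moreover have "walk (ts @ [x])"
      using d xD by (auto simp: walk_def successively_append_iff u_def)
    ultimately have "legal (ts @ [x])" using d xD by (auto simp: legal_def)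
    then show False using max[of "ts @ [x]"] by simp
  qed
  have entries: "length (filter (\<lambda>d. col (flip d) = v) ts) = card {d \<in> set ts. col (flip d) = v}" for v
    using d by (metis distinct_card distinct_filter set_filter)
  have entries_le: "length (filter (\<lambda>d. col (flip d) = v) ts) \<le> card {d \<in> D. col d = v}" for v
    unfolding entries card_entries[of v, symmetric] using d fin by (intro card_mono) auto
  have full_len: "length (w v) = card {d \<in> D. col d = v}" if "v \<in> col ` D" for v
    using wd[OF that] distinct_card by force
  \<comment> \<open>Entries into \<open>u\<close> would outnumber exits by one, but all exits from \<open>u\<close> are used.\<close>
  have u: "u = col r"
  proof (rule ccontr)
    assume "u \<noteq> col r"
    then have "length (filter (\<lambda>d. col (flip d) = u) ts) = Suc (length (w u))"
      using walk_balance[OF d(5,3), of u] d(4) full_u by (simp add: u_def[symmetric])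
    then show False using entries_le[of u] full_len[OF u_in] by simp
  qed
  have bal: "length (filter (\<lambda>d. col (flip d) = v) ts) = length (exits ts v)" for v
    using walk_balance[OF d(5,3), of v] d(4) u by (simp add: u_def[symmetric])
  obtain rank :: "'v \<Rightarrow> nat" where rank: "\<And>v. v \<in> others \<Longrightarrow> rank (col (flip (last (w v)))) < rank v"
    using w unfolding exit_orders_def parent_darts_def by blast
  have full: "exits ts v = w v" if "v \<in> col ` D" for v
    using that
  proof (induction "rank v" arbitrary: v rule: less_induct)
    case less
    show ?case
    proof (cases "v = col r")
      case True
      then show ?thesis using full_u u by simp
    next
      case False
      define x where "x = last (w v)"
      have v: "v \<in> others" using less.prems False by (simp add: others_def)
      have ne: "w v \<noteq> []" using wd(2)[OF less.prems] less.prems by auto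
      have x: "x \<in> D" "col x = v" using wd(2)[OF less.prems] ne last_in_set by (fastforce simp: x_def)+
      define y where "y = col (flip x)"
      have y: "y \<in> col ` D" using x flip_in by (simp add: y_def)
      have "exits ts y = w y"
        using less.hyps[of y] rank[OF v] y by (simp add: y_def x_def)
      then have "card {d \<in> set ts. col (flip d) = y} = card {d \<in> D. col (flip d) = y}"
        using bal[of y] entries[of y] full_len[OF y] card_entries[of y] by simp
      moreover have "{d \<in> set ts. col (flip d) = y} \<subseteq> {d \<in> D. col (flip d) = y}" using d by auto
      ultimately have "{d \<in> set ts. col (flip d) = y} = {d \<in> D. col (flip d) = y}"
        using fin by (intro card_subset_eq) auto
      then have "x \<in> set ts" using x by (auto simp: y_def)
      then have "x \<in> set (exits ts v)" using x by (simp add: exits_def)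
      moreover obtain zs where zs: "w v = exits ts v @ zs" using pre[OF less.prems] by (auto simp: prefix_def)
      moreover have "zs \<noteq> [] \<Longrightarrow> x \<in> set zs" using zs by (simp add: x_def)
      \<comment> \<open>The last dart \<open>x\<close> occurs only once, so nothing comes after the used darts.\<close>
      ultimately have "zs = []" using wd(1)[OF less.prems] by auto
      then show ?thesis using zs by simp
    qed
  qed
  have "D \<subseteq> set ts"
  proof
    fix x assume x: "x \<in> D"
    then have "x \<in> set (exits ts (col x))" using full[of "col x"] wd(2)[of "col x"] by simp
    then show "x \<in> set ts" by (simp add: exits_def)
  qed
  then have "tour ts" unfolding tour_def using d u by (auto simp: u_def)
  then show ?thesis using full by blast
qed

text \<open>A tree has only one direction towards the root. Otherwise an edge would be directed by \<open>p'\<close> from \<open>v\<close>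
  to \<open>x\<close> but by \<open>p\<close> from \<open>x\<close> to \<open>v\<close>. As \<open>x\<close> has smaller rank for \<open>p'\<close>, both agree at \<open>x\<close> by induction, so
  that \<open>p'\<close> leads from \<open>x\<close> back to \<open>v\<close>, against the rank.\<close>
lemma parent_darts_unique:
  assumes "parent_darts p" "parent_darts p'" "tree_edges p = tree_edges p'" "v \<in> others"
  shows "p v = p' v"
proof -
  have p: "p v \<in> D" "col (p v) = v" "p' v \<in> D" "col (p' v) = v" if "v \<in> others" for v
    using assms(1,2) that by (auto simp: parent_darts_def)
  obtain rank :: "'v \<Rightarrow> nat" where rank: "\<And>v. v \<in> others \<Longrightarrow> rank (col (flip (p' v))) < rank v"
    using assms(2) by (auto simp: parent_darts_def)
  show ?thesis using assms(4)
  proof (induction "rank v" arbitrary: v rule: less_induct)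
    case less
    have "{p' v, flip (p' v)} \<in> tree_edges p"
      unfolding assms(3) using less.prems by (auto simp: tree_edges_def)
    then obtain x where x: "x \<in> others" "{p' v, flip (p' v)} = {p x, flip (p x)}"
      by (auto simp: tree_edges_def)
    from x(2) consider "p' v = p x" | "p' v = flip (p x)" "flip (p' v) = p x"
      by (auto simp: doubleton_eq_iff)
    then show ?case
    proof cases
      case 1
      then show ?thesis using p[OF less.prems] p[OF x(1)] by metis
    next
      case 2
      have "rank x < rank v" using rank[OF less.prems] 2 p[OF x(1)] by simp
      moreover have "p x = p' x" using less.hyps calculation x(1) by blast
      ultimately show ?thesis using rank[OF x(1)] 2(1) p[OF less.prems] by simp
    qed
  qed
qed

end

section \<open>Spanning trees of maps\<close>

text \<open>Carries directed trees from the vertices of a map over to the names of the vertices.\<close>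
lemma (in dart_graph) parent_darts_relabel:
  assumes "inj_on l (col ` D)"
  shows "(\<exists>p. parent_darts p \<and> T = tree_edges p) \<longleftrightarrow>
    (\<exists>p. dart_graph.parent_darts D flip (\<lambda>d. l (col d)) r p \<and>
         T = dart_graph.tree_edges D flip (\<lambda>d. l (col d)) r p)"
proof -
  interpret L: dart_graph D flip "\<lambda>d. l (col d)" r
    by unfold_locales (fact fin flip_in flip_neq flip_flip r_in)+
  define k where "k = inv_into (col ` D) l"
  have kl: "k (l v) = v" if "v \<in> col ` D" for v using assms that by (simp add: k_def)
  have others: "L.others = l ` others"
    using inj_on_image_set_diff[OF assms, of "col ` D" "{col r}"] r_in
    by (simp add: others_def L.others_def image_image)
  have in_D: "v \<in> col ` D" if "v \<in> others" for v using that by (simp add: others_def)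
  show ?thesis
  proof
    assume "\<exists>p. parent_darts p \<and> T = tree_edges p"
    then obtain p and rank :: "'v \<Rightarrow> nat" where p: "\<And>v. v \<in> others \<Longrightarrow> p v \<in> D \<and> col (p v) = v"
      and rank: "\<And>v. v \<in> others \<Longrightarrow> rank (col (flip (p v))) < rank v" and T: "T = tree_edges p"
      unfolding parent_darts_def by blast
    have "L.parent_darts (\<lambda>x. p (k x))"
      unfolding L.parent_darts_def others
      using p rank kl in_D flip_in by (auto intro!: exI[of _ "\<lambda>x. rank (k x)"])
    moreover have "T = L.tree_edges (\<lambda>x. p (k x))"
      unfolding T tree_edges_def L.tree_edges_def others using kl in_D by (simp add: image_image)
    ultimately show "\<exists>p. L.parent_darts p \<and> T = L.tree_edges p" by blast
  next
    assume "\<exists>p. L.parent_darts p \<and> T = L.tree_edges p"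
    then obtain p and rank :: "_ \<Rightarrow> nat" where
      p: "\<And>v. v \<in> others \<Longrightarrow> p (l v) \<in> D \<and> l (col (p (l v))) = l v"
      and rank: "\<And>v. v \<in> others \<Longrightarrow> rank (l (col (flip (p (l v))))) < rank (l v)"
      and T: "T = L.tree_edges p"
      unfolding L.parent_darts_def others by blast
    have "col (p (l v)) = v" if "v \<in> others" for v
      using p[OF that] in_D[OF that] inj_onD[OF assms] by blast
    then have "parent_darts (\<lambda>v. p (l v))"
      unfolding parent_darts_def using p rank by (auto intro!: exI[of _ "\<lambda>v. rank (l v)"])
    moreover have "T = tree_edges (\<lambda>v. p (l v))"
      unfolding T tree_edges_def L.tree_edges_def others by (simp add: image_image)
    ultimately show "\<exists>p. parent_darts p \<and> T = tree_edges p" by blast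
  qed
qed

lemma rooted_map_dart_graph:
  assumes "rooted_map M"
  shows "dart_graph (darts M) (opp M) (root_dart M)"
  using assms by unfold_locales (auto simp: rooted_map_def permutes_in_image)

lemma relpow_shortest_path:
  assumes "(u, v) \<in> E\<^sup>*"
  obtains n f where "f 0 = u" "f n = v" "\<And>i. i < n \<Longrightarrow> (f i, f (Suc i)) \<in> E" "inj_on f {..n}"
proof -
  define n where "n = (LEAST n. (u, v) \<in> E ^^ n)"
  have "(u, v) \<in> E ^^ n" unfolding n_def using assms by (metis LeastI rtrancl_imp_relpow)
  then obtain f where f: "f 0 = u" "f n = v" "\<And>i. i < n \<Longrightarrow> (f i, f (Suc i)) \<in> E"
    unfolding relpow_fun_conv by blast
  have path: "(f i, f (i + k)) \<in> E ^^ k" if "i + k \<le> n" for i k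
    using that
  proof (induction k)
    case (Suc k)
    then show ?case using f(3)[of "i + k"] relpow_Suc_I[of "f i" "f (i + k)" k E] by simp
  qed simp
  have "f i \<noteq> f j" if "i < j" "j \<le> n" for i j
  proof
    assume "f i = f j"
    then have "(u, v) \<in> E ^^ i O E ^^ (n - j)"
      using path[of 0 i] path[of j "n - j"] that f by auto
    then have "(u, v) \<in> E ^^ (i + (n - j))" by (simp add: relpow_add)
    then have "n \<le> i + (n - j)" unfolding n_def by (rule Least_le)
    then show False using that by simp
  qed
  then have "inj_on f {..n}" by (metis atMost_iff inj_onI linorder_neqE_nat)
  then show thesis using that f by blast
qed

text \<open>Spanning trees are compared with directed trees before connectedness of the map is known: it will
  be the spanning tree itself that proves it. Therefore only the dart structure is assumed.\<close>
context
  fixes M :: "'d pre_map"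
  assumes M: "dart_graph (darts M) (opp M) (root_dart M)"
begin

interpretation dart_graph "darts M" "opp M" "vertex_of M" "root_dart M"
  by (rule M)

definition tree_step :: "'d set set \<Rightarrow> ('d set \<times> 'd set) set" where
  "tree_step T = {(vertex_of M d, vertex_of M (opp M d)) | d. d \<in> darts M \<and> edge_of M d \<in> T}"

lemma tree_stepI:
  "d \<in> darts M \<Longrightarrow> edge_of M d \<in> T \<Longrightarrow> (vertex_of M d, vertex_of M (opp M d)) \<in> tree_step T"
  by (auto simp: tree_step_def)

lemma tree_step_sym: "sym ((tree_step T)\<^sup>*)"
proof (rule sym_rtrancl, rule symI)
  fix u v assume "(u, v) \<in> tree_step T"
  then obtain d where d: "d \<in> darts M" "edge_of M d \<in> T" "u = vertex_of M d" "v = vertex_of M (opp M d)"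
    by (auto simp: tree_step_def)
  then have "edge_of M (opp M d) \<in> T" by (simp add: edge_of_def flip_flip insert_commute)
  then show "(v, u) \<in> tree_step T"
    using tree_stepI[of "opp M d" T] d flip_in flip_flip by simp
qed

lemma others_vertices: "others = vertices M - {vertex_of M (root_dart M)}"
  by (simp add: others_def vertices_def)

lemma tree_edges_edge_of: "tree_edges p = (\<lambda>v. edge_of M (p v)) ` others"
  by (simp add: tree_edges_def edge_of_def)

lemma edge_of_eq_iff:
  assumes "d \<in> darts M" "e \<in> darts M"
  shows "edge_of M d = edge_of M e \<longleftrightarrow> d = e \<or> d = opp M e"
  using assms by (auto simp: edge_of_def doubleton_eq_iff flip_flip)

lemma parent_darts_connected:
  assumes p: "parent_darts p"
  shows "connected_by M (tree_edges p)"
proof -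
  obtain rank :: "_ \<Rightarrow> nat" where rank: "\<And>v. v \<in> others \<Longrightarrow> rank (vertex_of M (opp M (p v))) < rank v"
    using p unfolding parent_darts_def by blast
  have pv: "p v \<in> darts M" "vertex_of M (p v) = v" if "v \<in> others" for v
    using p that by (auto simp: parent_darts_def)
  have root: "(v, vertex_of M (root_dart M)) \<in> (tree_step (tree_edges p))\<^sup>*" if "v \<in> vertices M" for v
    using that
  proof (induction "rank v" arbitrary: v rule: less_induct)
    case less
    show ?case
    proof (cases "v = vertex_of M (root_dart M)")
      case False
      then have v: "v \<in> others" using less.prems by (simp add: others_vertices)
      have "vertex_of M (opp M (p v)) \<in> vertices M" using pv[OF v] flip_in by (simp add: vertices_def)
      then have "(vertex_of M (opp M (p v)), vertex_of M (root_dart M)) \<in> (tree_step (tree_edges p))\<^sup>*"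
        using less.hyps rank[OF v] by blast
      moreover have "edge_of M (p v) \<in> tree_edges p" using v by (auto simp: tree_edges_edge_of)
      then have "(v, vertex_of M (opp M (p v))) \<in> tree_step (tree_edges p)"
        using tree_stepI[of "p v"] pv[OF v] by simp
      ultimately show ?thesis by (rule converse_rtrancl_into_rtrancl[rotated])
    qed simp
  qed
  show ?thesis
    unfolding connected_by_def tree_step_def[symmetric]
    by (meson root symD[OF tree_step_sym] rtrancl_trans)
qed

text \<open>At a vertex \<open>w\<close> of maximal rank on a cycle, both cycle edges lead to a vertex of at most the same
  rank. A tree edge that does so is the parent edge of \<open>w\<close>, so that both edges coincide and the
  cycle has length one. Its only dart would then be its own opposite.\<close>
lemma parent_darts_acyclic:
  assumes p: "parent_darts p"
  shows "\<not> is_cycle M (tree_edges p) ds"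
proof
  assume "is_cycle M (tree_edges p) ds"
  then have ds: "ds \<noteq> []" "set ds \<subseteq> darts M" "edge_of M ` set ds \<subseteq> tree_edges p"
    and next_v: "\<And>i. i < length ds \<Longrightarrow> vertex_of M (opp M (ds ! i)) = vertex_of M (ds ! (Suc i mod length ds))"
    and de: "distinct (map (edge_of M) ds)"
    by (auto simp: is_cycle_def)
  obtain rank :: "_ \<Rightarrow> nat" where rank: "\<And>v. v \<in> others \<Longrightarrow> rank (vertex_of M (opp M (p v))) < rank v"
    using p unfolding parent_darts_def by blast
  have pv: "p v \<in> darts M" "vertex_of M (p v) = v" if "v \<in> others" for v
    using p that by (auto simp: parent_darts_def)
  define n where "n = length ds"
  have n: "0 < n" using ds by (simp add: n_def)
  have top: "d = p (vertex_of M d)"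
    if d: "d \<in> darts M" "edge_of M d \<in> tree_edges p"
      "rank (vertex_of M (opp M d)) \<le> rank (vertex_of M d)" for d
  proof -
    obtain x where x: "x \<in> others" "edge_of M d = edge_of M (p x)"
      using d(2) unfolding tree_edges_edge_of by blast
    then have "d = p x \<or> d = opp M (p x)" using d pv by (simp add: edge_of_eq_iff)
    then show ?thesis using d(3) rank[OF x(1)] pv[OF x(1)] flip_flip by auto
  qed
  define R where "R i = rank (vertex_of M (ds ! i))" for i
  have "finite (R ` {..<n})" "R ` {..<n} \<noteq> {}" using n by auto
  then obtain i where i: "i < n" "Max (R ` {..<n}) = R i" using Max_in[of "R ` {..<n}"] by blast
  have R_max: "R j \<le> R i" if "j < n" for j
    unfolding i(2)[symmetric] using that by simp
  \<comment> \<open>The index of the predecessor on the cycle.\<close>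
  define j where "j = (i + n - 1) mod n"
  have j: "j < n" "Suc j mod n = i" using n i by (auto simp: j_def mod_Suc_eq)
  have i': "ds ! i \<in> darts M" "edge_of M (ds ! i) \<in> tree_edges p"
    "ds ! j \<in> darts M" "edge_of M (ds ! j) \<in> tree_edges p"
    using ds i j by (auto simp: n_def)
  have "ds ! i = p (vertex_of M (ds ! i))"
    using top[OF i'(1,2)] R_max[of "Suc i mod n"] next_v[of i] i n by (simp add: R_def n_def)
  moreover have "opp M (ds ! j) = p (vertex_of M (opp M (ds ! j)))"
  proof (rule top)
    show "edge_of M (opp M (ds ! j)) \<in> tree_edges p"
      using i' by (simp add: edge_of_def flip_flip insert_commute)
    show "rank (vertex_of M (opp M (opp M (ds ! j)))) \<le> rank (vertex_of M (opp M (ds ! j)))"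
      using next_v[of j] j i' R_max[OF j(1)] by (simp add: flip_flip R_def n_def)
  qed (use i' flip_in in auto)
  moreover have "vertex_of M (opp M (ds ! j)) = vertex_of M (ds ! i)"
    using next_v[of j] j by (simp add: n_def)
  ultimately have eq: "opp M (ds ! j) = ds ! i" by simp
  then have "edge_of M (ds ! j) = edge_of M (ds ! i)" using i' by (metis edge_of_eq_iff flip_flip)
  moreover have "edge_of M (ds ! k) = map (edge_of M) ds ! k" if "k < n" for k
    using that by (simp add: n_def)
  ultimately have "i = j" using nth_eq_iff_index_eq[OF de, of i j] i j by (simp add: n_def)
  then show False using eq flip_neq i' by auto
qed

text \<open>Breadth-first search: the parent of a vertex is a neighbor closer to the root.\<close>
lemma parent_darts_if_connected:
  assumes "connected_by M T"
  obtains p where "parent_darts p" "tree_edges p \<subseteq> T"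
proof -
  define rank where "rank v = (LEAST n. (v, vertex_of M (root_dart M)) \<in> tree_step T ^^ n)" for v
  have "\<exists>d. d \<in> darts M \<and> edge_of M d \<in> T \<and> vertex_of M d = v \<and> rank (vertex_of M (opp M d)) < rank v"
    if v: "v \<in> others" for v
  proof -
    have "(v, vertex_of M (root_dart M)) \<in> (tree_step T)\<^sup>*"
      using assms v r_in unfolding connected_by_def tree_step_def[symmetric] others_vertices
      by (auto simp: vertices_def)
    then have r: "(v, vertex_of M (root_dart M)) \<in> tree_step T ^^ rank v"
      unfolding rank_def by (metis LeastI rtrancl_imp_relpow)
    then obtain m where m: "rank v = Suc m"
      using v by (cases "rank v") (auto simp: others_vertices)
    then obtain y where y: "(v, y) \<in> tree_step T" "(y, vertex_of M (root_dart M)) \<in> tree_step T ^^ m"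
      using r by (metis relpow_Suc_D2)
    have "rank y \<le> m" unfolding rank_def using y(2) by (rule Least_le)
    then show ?thesis using y(1) m by (auto simp: tree_step_def)
  qed
  then obtain p where p: "\<And>v. v \<in> others \<Longrightarrow> p v \<in> darts M \<and> edge_of M (p v) \<in> T \<and>
      vertex_of M (p v) = v \<and> rank (vertex_of M (opp M (p v))) < rank v"
    by metis
  then have "parent_darts p" unfolding parent_darts_def by blast
  moreover have "tree_edges p \<subseteq> T" using p by (auto simp: tree_edges_edge_of)
  ultimately show thesis by (rule that)
qed

text \<open>The fundamental cycle of an edge \<open>d\<close> outside \<open>S\<close>: a shortest path in \<open>S\<close> back from the end of \<open>d\<close> has
  distinct vertices, and two of its edges can agree only if the path turns back.\<close>
lemma cycle_if_connected_without:
  assumes "connected_by M S" "S \<subseteq> T" "d \<in> darts M" "edge_of M d \<in> T - S"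
  shows "\<exists>ds. is_cycle M T ds"
proof -
  have "(vertex_of M (opp M d), vertex_of M d) \<in> (tree_step S)\<^sup>*"
    using assms(1,3) flip_in unfolding connected_by_def tree_step_def[symmetric]
    by (simp add: vertices_def)
  then obtain n f where f: "f 0 = vertex_of M (opp M d)" "f n = vertex_of M d"
    "\<And>i. i < n \<Longrightarrow> (f i, f (Suc i)) \<in> tree_step S" "inj_on f {..n}"
    by (rule relpow_shortest_path) blast
  have "\<exists>e. e \<in> darts M \<and> edge_of M e \<in> S \<and> vertex_of M e = f i \<and> vertex_of M (opp M e) = f (Suc i)"
    if "i < n" for i
    using f(3)[OF that] by (auto simp: tree_step_def)
  then obtain e where e: "\<And>i. i < n \<Longrightarrow> e i \<in> darts M \<and> edge_of M (e i) \<in> S \<and>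
      vertex_of M (e i) = f i \<and> vertex_of M (opp M (e i)) = f (Suc i)"
    by metis
  have f_eq: "f i = f j \<longleftrightarrow> i = j" if "i \<le> n" "j \<le> n" for i j
    using inj_on_eq_iff[OF f(4)] that by simp
  have "edge_of M (e i) \<noteq> edge_of M (e j)" if ij: "i < j" "j < n" for i j
  proof
    assume "edge_of M (e i) = edge_of M (e j)"
    then have "e i = e j \<or> e i = opp M (e j)" using e ij by (simp add: edge_of_eq_iff)
    then show False
    proof
      assume "e i = e j"
      then have "f i = f j" using e[of i] e[of j] ij by simp
      then show False using f_eq ij by simp
    next
      assume *: "e i = opp M (e j)"
      then have "f i = f (Suc j)" using e[of i] e[of j] ij by simp
      then show False using f_eq[of i "Suc j"] ij by simp
    qed
  qed
  then have inj_e: "inj_on (\<lambda>i. edge_of M (e i)) {0..<n}"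
    by (intro linorder_inj_onI) auto
  define ds where "ds = d # map e [0..<n]"
  have "vertex_of M (opp M (ds ! i)) = vertex_of M (ds ! (Suc i mod length ds))"
    if i: "i < length ds" for i
  proof -
    have "vertex_of M (opp M (ds ! i)) = f i"
      using i e f(1) by (cases i) (auto simp: ds_def)
    moreover have "vertex_of M (ds ! (Suc i mod length ds)) = f i"
      using i e f(2) by (cases "i = n") (auto simp: ds_def)
    ultimately show ?thesis by simp
  qed
  moreover have "distinct (map (vertex_of M) ds)"
  proof -
    have "map (vertex_of M) ds = f n # map f [0..<n]" using e f(2) by (simp add: ds_def)
    then show ?thesis using f_eq by (auto simp: distinct_map intro!: inj_onI)
  qed
  moreover have "distinct (map (edge_of M) ds)"
  proof -
    have "map (edge_of M) ds = edge_of M d # map (\<lambda>i. edge_of M (e i)) [0..<n]" by (simp add: ds_def)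
    moreover have "edge_of M d \<notin> set (map (\<lambda>i. edge_of M (e i)) [0..<n])" using e assms(4) by auto
    moreover have "distinct (map (\<lambda>i. edge_of M (e i)) [0..<n])" using inj_e by (simp add: distinct_map)
    ultimately show ?thesis by simp
  qed
  ultimately have "is_cycle M T ds"
    using assms(2,3,4) e unfolding is_cycle_def by (fastforce simp: ds_def)
  then show ?thesis ..
qed

text \<open>For the direction from left to right, breadth-first search finds a directed tree inside \<open>T\<close>. It
  exhausts \<open>T\<close>, as any further edge would close a cycle.\<close>
lemma spanning_tree_iff_parent_darts:
  "spanning_tree M T \<longleftrightarrow> (\<exists>p. parent_darts p \<and> T = tree_edges p)"
proof
  assume T: "spanning_tree M T"
  then obtain p where p: "parent_darts p" "tree_edges p \<subseteq> T"
    using parent_darts_if_connected by (auto simp: spanning_tree_def)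
  have "T \<subseteq> tree_edges p"
  proof
    fix t assume t: "t \<in> T"
    then obtain d where d: "d \<in> darts M" "t = edge_of M d"
      using T by (auto simp: spanning_tree_def edges_def)
    show "t \<in> tree_edges p"
    proof (rule ccontr)
      assume "t \<notin> tree_edges p"
      then have "\<exists>ds. is_cycle M T ds"
        using cycle_if_connected_without[OF parent_darts_connected[OF p(1)] p(2) d(1)] t d(2) by simp
      then show False using T by (simp add: spanning_tree_def)
    qed
  qed
  then show "\<exists>p. parent_darts p \<and> T = tree_edges p" using p by blast
next
  assume "\<exists>p. parent_darts p \<and> T = tree_edges p"
  then obtain p where p: "parent_darts p" "T = tree_edges p" by blast
  then have "T \<subseteq> edges M"
    by (auto simp: tree_edges_edge_of edges_def parent_darts_def)
  then show "spanning_tree M T"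
    unfolding spanning_tree_def p(2) using parent_darts_connected[OF p(1)] parent_darts_acyclic[OF p(1)]
    by blast
qed

end

section \<open>The correspondence between maps\<close>

definition dart_label :: "'d pre_map \<Rightarrow> ('d set \<Rightarrow> nat) \<Rightarrow> 'd \<Rightarrow> nat" where
  "dart_label M c d = c (vertex_of M d)"

definition face_list :: "'d pre_map \<Rightarrow> 'd list" where
  "face_list M = orbit_list (face_perm M) (root_dart M)"

definition face_exits :: "'d pre_map \<Rightarrow> ('d set \<Rightarrow> nat) \<Rightarrow> nat \<Rightarrow> 'd list" where
  "face_exits M c v = dart_graph.exits (dart_label M c) (face_list M) v"

definition last_exit_edges :: "'d pre_map \<Rightarrow> ('d set \<Rightarrow> nat) \<Rightarrow> 'd set set" where
  "last_exit_edges M c = dart_graph.tree_edges (darts M) (opp M) (dart_label M c) (root_dart M)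
     (\<lambda>v. last (face_exits M c v))"

text \<open>The correspondence of the theorem, on representatives. The values of the labels are compared on darts
  because the vertices of the two maps are different sets of darts.\<close>
fun corresponds :: "'d labelled \<Rightarrow> 'd tree_labelled \<Rightarrow> bool" where
  "corresponds (M, c) ((N, l), T) \<longleftrightarrow> darts N = darts M \<and> opp N = opp M \<and>
     root_dart N = root_dart M \<and> (\<forall>d\<in>darts M. dart_label N l d = dart_label M c d) \<and>
     (\<forall>v\<in>dart_label M c ` darts M. cyclic_list (ccw N) (face_exits M c v)) \<and>
     T = last_exit_edges M c"

lemma labelled_iso_iff_dart_label:
  assumes "rooted_map M"
  shows "labelled_iso f (M, c) (N, c') \<longleftrightarrow>
    map_iso f M N \<and> (\<forall>d\<in>darts M. dart_label N c' (f d) = dart_label M c d)"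
proof -
  have "(\<forall>v\<in>vertices M. c' (f ` v) = c v) \<longleftrightarrow>
      (\<forall>d\<in>darts M. dart_label N c' (f d) = dart_label M c d)" if "map_iso f M N"
    using map_iso_vertex_of[OF assms that] by (simp add: dart_label_def vertices_def)
  then show ?thesis by auto
qed

lemma rooted_map_permutes:
  assumes "rooted_map M"
  shows "ccw M permutes darts M" "face_perm M permutes darts M" "finite (darts M)"
    and "permutation (ccw M)" "permutation (face_perm M)"
proof -
  show ccw: "ccw M permutes darts M" and fin: "finite (darts M)" using assms by (simp_all add: rooted_map_def)
  have "opp M permutes darts M" using assms by (simp add: rooted_map_def)
  then show face: "face_perm M permutes darts M" unfolding face_perm_def using ccw by (rule permutes_compose)
  show "permutation (ccw M)" "permutation (face_perm M)"
    using ccw face fin by (auto simp: permutation_permutes)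
qed

lemma vertex_of_ccw:
  assumes "rooted_map M"
  shows "vertex_of M (ccw M d) = vertex_of M d"
  unfolding vertex_of_def by (rule permutation_orbit_step[OF rooted_map_permutes(4)[OF assms]])

text \<open>The next dart along the face lies at the vertex to which the present dart leads.\<close>
lemma face_list_tour:
  assumes M: "rooted_map M" and uni: "unicellular M"
  shows "cyclic_list (face_perm M) (face_list M)"
    and "dart_graph.tour (darts M) (opp M) (dart_label M c) (root_dart M) (face_list M)"
proof -
  interpret dart_graph "darts M" "opp M" "dart_label M c" "root_dart M"
    by (rule rooted_map_dart_graph[OF M])
  note perm = rooted_map_permutes[OF M]
  show cyc: "cyclic_list (face_perm M) (face_list M)"
    unfolding face_list_def by (rule cyclic_list_orbit_list[OF perm(2,3)])
  have hd: "hd (face_list M) = root_dart M"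
    unfolding face_list_def by (rule cyclic_list_orbit_list[OF perm(2,3)])
  have "set (face_list M) = face_of M (root_dart M)"
    unfolding face_list_def face_of_def by (rule cyclic_list_orbit_list[OF perm(2,3)])
  also have "\<dots> = darts M"
  proof
    show "face_of M (root_dart M) \<subseteq> darts M"
      unfolding face_of_def by (rule permutes_orbit_subset[OF perm(2) r_in])
    show "darts M \<subseteq> face_of M (root_dart M)"
    proof
      fix d assume d: "d \<in> darts M"
      have "d \<in> face_of M d"
        unfolding face_of_def by (rule permutation_self_in_orbit[OF perm(5)])
      moreover have "face_of M d = face_of M (root_dart M)"
        using uni d r_in unfolding unicellular_def faces_def
        by (metis card_1_singletonE image_eqI singletonD)
      ultimately show "d \<in> face_of M (root_dart M)" by simp
    qed
  qed
  finally have set: "set (face_list M) = darts M" .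
  have step: "dart_label M c (opp M d) = dart_label M c (face_perm M d)" for d
    using vertex_of_ccw[OF M] by (simp add: dart_label_def face_perm_def)
  have "walk (face_list M)"
    unfolding walk_def successively_conv_nth step
    using cyclic_list_nth[OF cyc] by simp
  moreover have "dart_label M c (opp M (last (face_list M))) = dart_label M c (root_dart M)"
    using step cyclic_list_last[OF cyc] hd by simp
  ultimately show "tour (face_list M)"
    using cyc set hd by (simp add: tour_def cyclic_list_def)
qed

lemma vertex_of_fibre:
  assumes "\<And>v. v \<in> col ` darts N \<Longrightarrow> cyclic_list (ccw N) (w v) \<and> set (w v) = {d \<in> darts N. col d = v}"
    and "d \<in> darts N"
  shows "vertex_of N d = {e \<in> darts N. col e = col d}"
proof -
  have "cyclic_list (ccw N) (w (col d))" "set (w (col d)) = {e \<in> darts N. col e = col d}"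
    using assms by auto
  then show ?thesis using cyclic_list_orbit[of "ccw N" "w (col d)" d] assms(2) by (simp add: vertex_of_def)
qed

text \<open>Turns a labelling of darts into a labelling of vertices. The equation holds on all of the type, also
  outside the darts of the map, so that it can be used for rewriting.\<close>
lemma dart_label_of_invariant:
  assumes "\<And>d. col (ccw M d) = col d"
  shows "dart_label M (\<lambda>v. col (SOME d. d \<in> v)) = col"
proof
  fix d
  have const: "col x = col d" if "x \<in> orbit (ccw M) d" for x
    using that by induction (simp_all add: assms)
  have "(SOME x. x \<in> vertex_of M d) \<in> vertex_of M d"
    unfolding vertex_of_def by (rule someI[of _ "ccw M d"]) (rule orbit.base)
  then show "dart_label M (\<lambda>v. col (SOME d. d \<in> v)) d = col d"
    unfolding dart_label_def vertex_of_def by (rule const)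
qed

lemma spanning_tree_iff_label_parents:
  assumes M: "dart_graph (darts M) (opp M) (root_dart M)" and l: "inj_on l (vertices M)"
  shows "spanning_tree M T \<longleftrightarrow>
    (\<exists>p. dart_graph.parent_darts (darts M) (opp M) (dart_label M l) (root_dart M) p \<and>
         T = dart_graph.tree_edges (darts M) (opp M) (dart_label M l) (root_dart M) p)"
proof -
  have "inj_on l (vertex_of M ` darts M)" using l by (simp add: vertices_def)
  note dart_graph.parent_darts_relabel[OF M this, of T]
  then show ?thesis unfolding spanning_tree_iff_parent_darts[OF M] dart_label_def[abs_def] .
qed

lemma connected_by_mono:
  assumes "connected_by M S" "S \<subseteq> T"
  shows "connected_by M T"
proof -
  have "{(vertex_of M d, vertex_of M (opp M d)) | d. d \<in> darts M \<and> edge_of M d \<in> S}\<^sup>* \<subseteq>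
    {(vertex_of M d, vertex_of M (opp M d)) | d. d \<in> darts M \<and> edge_of M d \<in> T}\<^sup>*"
    using assms(2) by (intro rtrancl_mono) blast
  then show ?thesis using assms(1) unfolding connected_by_def by blast
qed

text \<open>The new rotation is, at each color, the cycle through the exits of the tour along the face.\<close>
lemma corresponds_tree_exists:
  assumes "(M, c) \<in> pre_colored_unicellular n q"
  shows "\<exists>Z \<in> pre_tree_rooted n q. corresponds (M, c) Z"
proof -
  have M: "rooted_map M" and uni: "unicellular M" and n: "card (edges M) = n"
    and c: "c ` vertices M = {1..q}"
    using assms by (auto simp: pre_colored_unicellular_def)
  define col where "col = dart_label M c"
  interpret dart_graph "darts M" "opp M" col "root_dart M"
    by (rule rooted_map_dart_graph[OF M])
  have colours: "col ` darts M = {1..q}"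
    using c by (simp add: col_def dart_label_def vertices_def image_image)
  define w where "w = face_exits M c"
  have w_eq: "w = exits (face_list M)" unfolding w_def face_exits_def[abs_def] col_def ..
  have orders: "exit_orders w"
    unfolding w_eq using face_list_tour(2)[OF M uni] tour_exit_orders by (simp add: col_def)
  have wd: "distinct (w v)" "set (w v) = {d \<in> darts M. col d = v}" "w v \<noteq> []"
    if "v \<in> col ` darts M" for v
  proof -
    show "distinct (w v)" and set: "set (w v) = {d \<in> darts M. col d = v}"
      using orders that by (auto simp: exit_orders_def)
    show "w v \<noteq> []" using set that by auto
  qed
  define \<sigma> where "\<sigma> d = (if d \<in> darts M then cycle_of_list (w (col d)) d else d)" for d
  have cyc: "cyclic_list \<sigma> (w v)" if v: "v \<in> col ` darts M" for v
  proof -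
    have "map \<sigma> (w v) = map (cycle_of_list (w v)) (w v)"
      using wd(2)[OF v] by (auto simp: \<sigma>_def)
    then show ?thesis
      using cyclic_list_cycle_of_list[OF wd(1,3)[OF v]] unfolding cyclic_list_def by metis
  qed
  have col_\<sigma>: "\<sigma> d \<in> darts M \<and> col (\<sigma> d) = col d" if "d \<in> darts M" for d
  proof -
    have "\<sigma> d \<in> set (w (col d))"
      using cyclic_list_image[OF cyc[of "col d"]] wd(2)[of "col d"] that by blast
    then show ?thesis using wd(2)[of "col d"] that by simp
  qed
  have "darts M \<subseteq> \<sigma> ` darts M"
  proof
    fix d assume d: "d \<in> darts M"
    then have "d \<in> \<sigma> ` set (w (col d))"
      using cyclic_list_image[OF cyc[of "col d"]] wd(2)[of "col d"] by simp
    then show "d \<in> \<sigma> ` darts M" using wd(2)[of "col d"] d by auto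
  qed
  then have "\<sigma> ` darts M = darts M" using col_\<sigma> by blast
  then have "bij_betw \<sigma> (darts M) (darts M)" using fin by (simp add: bij_betw_def eq_card_imp_inj_on)
  then have perm: "\<sigma> permutes darts M" by (rule bij_imp_permutes) (simp add: \<sigma>_def)
  define N where "N = M\<lparr>ccw := \<sigma>\<rparr>"
  define l where "l v = col (SOME d. d \<in> v)" for v :: "nat set"
  have N: "darts N = darts M" "opp N = opp M" "root_dart N = root_dart M" "ccw N = \<sigma>"
    by (simp_all add: N_def)
  have "col (ccw N d) = col d" for d unfolding N using col_\<sigma>[of d] by (simp add: \<sigma>_def)
  then have label: "dart_label N l = col" unfolding l_def[abs_def] by (rule dart_label_of_invariant)
  have fibre: "vertex_of N d = {e \<in> darts M. col e = col d}" if "d \<in> darts M" for d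
    using vertex_of_fibre[of col N w d] cyc wd(2) that by (simp add: N)
  have l_vertex: "l (vertex_of N d) = col d" for d
    using fun_cong[OF label, of d] by (simp add: dart_label_def)
  have inj_l: "inj_on l (vertices N)"
  proof (rule inj_onI)
    fix u v assume "u \<in> vertices N" "v \<in> vertices N" and eq: "l u = l v"
    then obtain d e where d: "d \<in> darts M" "u = vertex_of N d" and e: "e \<in> darts M" "v = vertex_of N e"
      by (auto simp: vertices_def N)
    have "col d = col e" using eq d(2) e(2) l_vertex by simp
    then show "u = v" using d e fibre by simp
  qed
  have "l ` vertices N = {1..q}"
    using colours by (simp add: vertices_def N image_image l_vertex)
  then have bij_l: "bij_betw l (vertices N) {1..q}" using inj_l by (simp add: bij_betw_def)
  define T where "T = tree_edges (\<lambda>v. last (w v))"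
  have edges: "edges N = edges M" by (simp add: edges_def edge_of_def[abs_def] N)
  have "parent_darts (\<lambda>v. last (w v))" using orders by (simp add: exit_orders_def)
  then have "\<exists>p. parent_darts p \<and> T = tree_edges p" unfolding T_def by blast
  then have tree: "spanning_tree N T"
    using spanning_tree_iff_label_parents[of N l T] inj_l dart_graph_axioms unfolding N label by simp
  have "connected_by N (edges N)"
    using tree connected_by_mono by (auto simp: spanning_tree_def)
  then have rooted: "rooted_map N"
    using M perm by (simp add: rooted_map_def N)
  have "((N, l), T) \<in> pre_tree_rooted n q"
    using rooted n bij_l tree edges by (simp add: pre_tree_rooted_def)
  moreover have "corresponds (M, c) ((N, l), T)"
    using cyc by (simp add: N label w_def[symmetric] col_def[symmetric] last_exit_edges_def T_def)
  ultimately show ?thesis by blast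
qed

text \<open>The darts at each vertex are ordered so as to end with the dart towards the root, or to start with
  the root dart. The resulting tour, closed up to a cycle, becomes the face permutation of the new
  map, whose rotation is hence its composition with the edge involution.\<close>
lemma corresponds_unicellular_exists:
  assumes "((N, l), T) \<in> pre_tree_rooted n q"
  shows "\<exists>X \<in> pre_colored_unicellular n q. corresponds X ((N, l), T)"
proof -
  have N: "rooted_map N" and n: "card (edges N) = n"
    and l: "bij_betw l (vertices N) {1..q}" and T: "spanning_tree N T"
    using assms by (auto simp: pre_tree_rooted_def)
  define col where "col = dart_label N l"
  interpret dart_graph "darts N" "opp N" col "root_dart N"
    by (rule rooted_map_dart_graph[OF N])
  note perm = rooted_map_permutes[OF N]
  have inj_l: "inj_on l (vertices N)" using l by (simp add: bij_betw_def)
  have colours: "col ` darts N = {1..q}"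
    using l by (simp add: col_def dart_label_def vertices_def image_image bij_betw_def)
  obtain p where p: "parent_darts p" "T = tree_edges p"
    using T spanning_tree_iff_label_parents[OF dart_graph_axioms inj_l, of T] by (auto simp: col_def)
  have pv: "p v \<in> darts N" "col (p v) = v" if "v \<in> others" for v
    using p that by (auto simp: parent_darts_def)
  have fibre: "orbit (ccw N) d = {e \<in> darts N. col e = col d}" if d: "d \<in> darts N" for d
  proof
    show "orbit (ccw N) d \<subseteq> {e \<in> darts N. col e = col d}"
    proof
      fix e assume e: "e \<in> orbit (ccw N) d"
      then have "vertex_of N e = vertex_of N d"
        unfolding vertex_of_def
        by (meson cyclic_on_orbit'[OF perm(4)] orbit_cyclic_eq3)
      then show "e \<in> {e \<in> darts N. col e = col d}"
        using e permutes_orbit_subset[OF perm(1) d] by (auto simp: col_def dart_label_def)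
    qed
    show "{e \<in> darts N. col e = col d} \<subseteq> orbit (ccw N) d"
    proof clarify
      fix e assume e: "e \<in> darts N" "col e = col d"
      then have "vertex_of N e = vertex_of N d"
        using d by (intro inj_onD[OF inj_l]) (auto simp: col_def dart_label_def vertices_def)
      then have "orbit (ccw N) e = orbit (ccw N) d" by (simp add: vertex_of_def)
      then show "e \<in> orbit (ccw N) d" using permutation_self_in_orbit[OF perm(4)] by blast
    qed
  qed
  have ccw: "ccw N d \<in> darts N \<and> col (ccw N d) = col d" if d: "d \<in> darts N" for d
    using fibre[OF d] orbit.base[of "ccw N" d] by blast
  \<comment> \<open>The dart after the tree dart comes first, which puts the tree dart last.\<close>
  define first where "first v = (if v = col (root_dart N) then root_dart N else ccw N (p v))" for v
  define w where "w v = orbit_list (ccw N) (first v)" for v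
  have first: "first v \<in> darts N" "col (first v) = v" if "v \<in> col ` darts N" for v
    using that pv[of v] ccw[of "p v"] r_in by (auto simp: first_def others_def)
  have cyc: "cyclic_list (ccw N) (w v)" and hd_w: "hd (w v) = first v" for v
    unfolding w_def by (rule cyclic_list_orbit_list[OF perm(1,3)])+
  have set_w: "set (w v) = {d \<in> darts N. col d = v}" if "v \<in> col ` darts N" for v
    unfolding w_def using fibre[of "first v"] first[OF that]
    by (simp add: cyclic_list_orbit_list(2)[OF perm(1,3)])
  have last_w: "last (w v) = p v" if v: "v \<in> others" for v
  proof -
    have "ccw N (last (w v)) = ccw N (p v)"
      using cyclic_list_last[OF cyc] hd_w v by (simp add: first_def others_def)
    then show ?thesis using permutes_inj[OF perm(1)] by (simp add: inj_eq)
  qed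
  have "parent_darts (\<lambda>v. last (w v))"
    using p(1) last_w by (simp add: parent_darts_def)
  then have "exit_orders w"
    using cyc set_w hd_w by (simp add: exit_orders_def cyclic_list_def first_def)
  then obtain ts where ts: "tour ts" and exits_ts: "\<And>v. v \<in> col ` darts N \<Longrightarrow> exits ts v = w v"
    using exit_orders_tour by blast
  have tsD: "distinct ts" "set ts = darts N" "hd ts = root_dart N" "walk ts"
    "col (opp N (last ts)) = col (root_dart N)"
    using ts unfolding tour_def by blast+
  have ts_ne: "ts \<noteq> []" using tour_nonempty[OF ts] .
  define \<phi> where "\<phi> = cycle_of_list ts"
  have \<phi>: "\<phi> permutes darts N" unfolding \<phi>_def tsD(2)[symmetric] by (rule cycle_permutes)
  have cyc_\<phi>: "cyclic_list \<phi> ts" unfolding \<phi>_def using tsD(1) ts_ne by (rule cyclic_list_cycle_of_list)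
  have col_\<phi>: "col (\<phi> d) = col (opp N d)" if "d \<in> darts N" for d
  proof -
    have "d \<in> set ts" using that tsD(2) by simp
    then obtain i where i: "i < length ts" "d = ts ! i" by (auto simp: in_set_conv_nth)
    show ?thesis
    proof (cases "Suc i < length ts")
      case True
      then show ?thesis
        using cyclic_list_nth[OF cyc_\<phi> i(1)] i(2) tsD(4) by (simp add: walk_def successively_conv_nth)
    next
      case False
      then have "i = length ts - 1" using i(1) by simp
      then have "d = last ts" using i(2) ts_ne by (simp add: last_conv_nth)
      then show ?thesis using cyclic_list_last[OF cyc_\<phi>] tsD(3,5) by simp
    qed
  qed
  define M where "M = N\<lparr>ccw := \<phi> \<circ> opp N\<rparr>"
  define c where "c v = col (SOME d. d \<in> v)" for v :: "nat set"
  have M: "darts M = darts N" "opp M = opp N" "root_dart M = root_dart N" "ccw M = \<phi> \<circ> opp N"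
    by (simp_all add: M_def)
  have opp: "opp N permutes darts N" using N by (simp add: rooted_map_def)
  have "opp N (opp N d) = d" for d
    using flip_flip permutes_not_in[OF opp] by (cases "d \<in> darts N") auto
  then have face: "face_perm M = \<phi>" by (simp add: face_perm_def M fun_eq_iff)
  have col_ccw: "col (ccw M d) = col d" for d
    using col_\<phi>[of "opp N d"] flip_in flip_flip permutes_not_in[OF opp, of d] permutes_not_in[OF \<phi>, of d]
    by (cases "d \<in> darts N") (auto simp: M)
  then have label: "dart_label M c = col" unfolding c_def[abs_def] by (rule dart_label_of_invariant)
  have ccw_perm: "ccw M permutes darts N" unfolding M by (rule permutes_compose[OF opp \<phi>])
  then have ccw_permutation: "permutation (ccw M)" using fin by (auto simp: permutation_permutes)
  have orbit_\<phi>: "orbit \<phi> d = darts N" if "d \<in> darts N" for d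
    using cyclic_list_orbit[OF cyc_\<phi>] that tsD(2) by simp
  then have "faces M = {darts N}"
    using r_in by (auto simp: faces_def face_of_def face M)
  then have uni: "unicellular M" by (simp add: unicellular_def)
  have "connected_by M (edges M)"
    unfolding connected_by_def
  proof (intro ballI)
    fix u v assume "u \<in> vertices M" "v \<in> vertices M"
    then obtain d e where d: "d \<in> darts N" "u = vertex_of M d" and e: "e \<in> darts N" "v = vertex_of M e"
      by (auto simp: vertices_def M)
    define E where "E = {(vertex_of M d, vertex_of M (opp M d)) | d. d \<in> darts M \<and> edge_of M d \<in> edges M}"
    have E_step: "(vertex_of M x, vertex_of M (\<phi> x)) \<in> E" if x: "x \<in> darts N" for x
    proof -
      have "\<phi> x = ccw M (opp N x)" using x flip_flip by (simp add: M)
      then have "vertex_of M (\<phi> x) = vertex_of M (opp M x)"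
        unfolding vertex_of_def M(2) using permutation_orbit_step[OF ccw_permutation] by simp
      then show ?thesis using x by (auto simp: E_def M edges_def)
    qed
    have "(u, vertex_of M x) \<in> E\<^sup>*" if "x \<in> orbit \<phi> d" for x
      using that
    proof induction
      case base
      then show ?case using E_step[OF d(1)] d(2) by blast
    next
      case (step y)
      then have "y \<in> darts N" using orbit_\<phi>[OF d(1)] by simp
      then have "(vertex_of M y, vertex_of M (\<phi> y)) \<in> E" by (rule E_step)
      with step.IH show ?case by (rule rtrancl_into_rtrancl)
    qed
    then show "(u, v) \<in> {(vertex_of M d, vertex_of M (opp M d)) | d. d \<in> darts M \<and> edge_of M d \<in> edges M}\<^sup>*"
      using orbit_\<phi>[OF d(1)] e unfolding E_def by blast
  qed
  then have rooted: "rooted_map M" using N ccw_perm by (simp add: rooted_map_def M)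
  have "edges M = edges N" by (simp add: edges_def edge_of_def[abs_def] M)
  moreover have "c ` vertices M = {1..q}"
    using colours fun_cong[OF label] by (simp add: vertices_def M image_image dart_label_def)
  ultimately have "(M, c) \<in> pre_colored_unicellular n q"
    using rooted uni n by (simp add: pre_colored_unicellular_def)
  moreover have "corresponds (M, c) ((N, l), T)"
  proof -
    have "face_list M = ts"
      unfolding face_list_def face M tsD(3)[symmetric] by (rule orbit_list_cyclic_list[OF cyc_\<phi>])
    then have exits_M: "face_exits M c v = w v" if "v \<in> col ` darts N" for v
      using exits_ts[OF that] by (simp add: face_exits_def label)
    have "last_exit_edges M c = tree_edges (\<lambda>v. last (face_exits M c v))"
      by (simp add: last_exit_edges_def M label)
    also have "\<dots> = tree_edges p"
      using exits_M last_w by (simp add: tree_edges_def others_def)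
    finally show ?thesis
      using exits_M cyc p(2) by (simp add: M label col_def[symmetric])
  qed
  ultimately show ?thesis by blast
qed

section \<open>Invariance under isomorphism\<close>

lemma edge_count_cong:
  assumes "edges M = edges N" "\<And>d. d \<in> darts M \<Longrightarrow> dart_label N l d = dart_label M c d" "rooted_map M"
  shows "edge_count M c i j = edge_count N l i j"
proof -
  have "(\<lambda>d. c (vertex_of M d)) ` e = (\<lambda>d. l (vertex_of N d)) ` e" if "e \<in> edges M" for e
  proof -
    have "e \<subseteq> darts M" using that rooted_map_closed(2)[OF assms(3)] by (auto simp: edges_def edge_of_def)
    then show ?thesis using assms(2) by (intro image_cong) (auto simp: dart_label_def)
  qed
  then have "{e \<in> edges M. (\<lambda>d. c (vertex_of M d)) ` e = {i, j}} =
    {e \<in> edges M. (\<lambda>d. l (vertex_of N d)) ` e = {i, j}}" by auto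
  then show ?thesis unfolding edge_count_def assms(1) by simp
qed

lemma edge_count_labelled_iso:
  assumes "rooted_map M" "labelled_iso f (M, c) (N, l)"
  shows "edge_count M c i j = edge_count N l i j"
proof -
  have f: "map_iso f M N" and lab: "\<And>d. d \<in> darts M \<Longrightarrow> l (vertex_of N (f d)) = c (vertex_of M d)"
    using assms(2) unfolding labelled_iso_iff_dart_label[OF assms(1)] by (auto simp: dart_label_def)
  have inj: "inj_on f (darts M)" and surj: "f ` darts M = darts N"
    using f by (auto simp: map_iso_def bij_betw_def)
  have edge: "f ` edge_of M d = edge_of N (f d)" if "d \<in> darts M" for d
    using f that by (auto simp: map_iso_def edge_of_def)
  then have edges: "edges N = (\<lambda>e. f ` e) ` edges M"
    unfolding edges_def surj[symmetric] image_image by (intro image_cong) auto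
  have sub: "e \<subseteq> darts M" if "e \<in> edges M" for e
    using that rooted_map_closed(2)[OF assms(1)] by (auto simp: edges_def edge_of_def)
  have img: "(\<lambda>d. l (vertex_of N d)) ` f ` e = (\<lambda>d. c (vertex_of M d)) ` e" if "e \<in> edges M" for e
    unfolding image_image using lab sub[OF that] by (intro image_cong) auto
  have "{e \<in> edges N. (\<lambda>d. l (vertex_of N d)) ` e = {i, j}} =
    (\<lambda>e. f ` e) ` {e \<in> edges M. (\<lambda>d. c (vertex_of M d)) ` e = {i, j}}"
    unfolding edges using img by auto
  moreover have "inj_on (\<lambda>e. f ` e) {e \<in> edges M. (\<lambda>d. c (vertex_of M d)) ` e = {i, j}}"
    by (rule inj_on_subset[OF inj_on_image_Pow[OF inj]]) (use sub in blast)
  ultimately show ?thesis unfolding edge_count_def by (simp add: card_image)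
qed

text \<open>What isomorphisms on the two sides of the correspondence have in common: everything except for the
  rotations and the trees.\<close>
definition dart_iso :: "('d \<Rightarrow> 'e) \<Rightarrow> 'd pre_map \<Rightarrow> ('d set \<Rightarrow> nat) \<Rightarrow> 'e pre_map \<Rightarrow> ('e set \<Rightarrow> nat) \<Rightarrow> bool" where
  "dart_iso f M c N c' \<longleftrightarrow> bij_betw f (darts M) (darts N) \<and> f (root_dart M) = root_dart N \<and>
     (\<forall>d\<in>darts M. f (opp M d) = opp N (f d) \<and> dart_label N c' (f d) = dart_label M c d)"

lemma labelled_iso_iff_dart_iso:
  assumes "rooted_map M"
  shows "labelled_iso f (M, c) (N, c') \<longleftrightarrow>
    dart_iso f M c N c' \<and> (\<forall>d\<in>darts M. f (ccw M d) = ccw N (f d))"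
  unfolding labelled_iso_iff_dart_label[OF assms] by (auto simp: dart_iso_def map_iso_def)

context
  fixes M :: "'d pre_map" and c and N :: "'d pre_map" and l and S
    and M' :: "'e pre_map" and c' and N' :: "'e pre_map" and l' and S' and f :: "'d \<Rightarrow> 'e"
  assumes M: "rooted_map M" "unicellular M" and M': "rooted_map M'" "unicellular M'"
    and MN: "corresponds (M, c) ((N, l), S)" and MN': "corresponds (M', c') ((N', l'), S')"
    and iso: "dart_iso f M c M' c'"
begin

interpretation G: dart_graph "darts M" "opp M" "dart_label M c" "root_dart M"
  by (rule rooted_map_dart_graph[OF M(1)])

interpretation G': dart_graph "darts M'" "opp M'" "dart_label M' c'" "root_dart M'"
  by (rule rooted_map_dart_graph[OF M'(1)])

lemma f_darts: "inj_on f (darts M)" "f ` darts M = darts M'" "d \<in> darts M \<Longrightarrow> f d \<in> darts M'"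
  and f_opp: "d \<in> darts M \<Longrightarrow> f (opp M d) = opp M' (f d)"
  and f_label: "d \<in> darts M \<Longrightarrow> dart_label M' c' (f d) = dart_label M c d"
  and f_root: "f (root_dart M) = root_dart M'"
  using iso by (auto simp: dart_iso_def bij_betw_def)

lemma tours: "G.tour (face_list M)" "G'.tour (face_list M')"
  using face_list_tour(2) M M' by blast+

lemma face_list_facts:
  "cyclic_list (face_perm M) (face_list M)" "cyclic_list (face_perm M') (face_list M')"
  "set (face_list M) = darts M" "hd (face_list M) = root_dart M" "hd (face_list M') = root_dart M'"
  using face_list_tour(1) M M' tours by (auto simp: G.tour_def G'.tour_def)

lemma colours_eq: "dart_label M' c' ` darts M' = dart_label M c ` darts M"
  unfolding f_darts(2)[symmetric] image_image by (rule image_cong) (simp_all add: f_label)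

lemma others_eq: "G'.others = G.others"
  unfolding G.others_def G'.others_def colours_eq using f_label[OF G.r_in] f_root by simp

lemma exits_map:
  assumes "set ts \<subseteq> darts M"
  shows "G'.exits (map f ts) v = map f (G.exits ts v)"
proof -
  have "filter (\<lambda>d. dart_label M' c' (f d) = v) ts = filter (\<lambda>d. dart_label M c d = v) ts"
    using assms f_label by (intro filter_cong) auto
  then show ?thesis by (simp add: G.exits_def G'.exits_def filter_map comp_def)
qed

lemma tour_map: "G'.tour (map f (face_list M))"
proof -
  have ts: "distinct (face_list M)" "set (face_list M) = darts M" "hd (face_list M) = root_dart M"
    "G.walk (face_list M)" "dart_label M c (opp M (last (face_list M))) = dart_label M c (root_dart M)"
    using tours(1) unfolding G.tour_def by blast+
  have ne: "face_list M \<noteq> []" using G.tour_nonempty[OF tours(1)] .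
  have step: "dart_label M' c' (opp M' (f d)) = dart_label M c (opp M d)" if "d \<in> darts M" for d
    using that by (simp add: f_opp[symmetric] f_label G.flip_in)
  have "G'.walk (map f (face_list M))"
    unfolding G'.walk_def successively_map
    by (rule successively_mono[OF ts(4)[unfolded G.walk_def]]) (use ts(2) step f_label in auto)
  moreover have "last (face_list M) \<in> darts M" using ne ts(2) last_in_set by blast
  ultimately show ?thesis
    unfolding G'.tour_def
    using ts ne f_darts step f_root f_label[OF G.r_in] by (simp add: distinct_map hd_map last_map)
qed

lemma face_list_map_iff_exits:
  "face_list M' = map f (face_list M) \<longleftrightarrow>
   (\<forall>v\<in>dart_label M c ` darts M. face_exits M' c' v = map f (face_exits M c v))"
proof -
  have "map f (face_exits M c v) = G'.exits (map f (face_list M)) v" for v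
    by (simp add: exits_map face_list_facts face_exits_def)
  then show ?thesis
    using G'.tour_eqI[OF tours(2) tour_map] by (auto simp: face_exits_def colours_eq)
qed

text \<open>The rotation and the face permutation of a map determine each other through the edge involution, and
  so do the face permutation and its cycle at the root, since there is only one face.\<close>
lemma face_list_map_iff_ccw:
  "face_list M' = map f (face_list M) \<longleftrightarrow> (\<forall>d\<in>darts M. f (ccw M d) = ccw M' (f d))"
proof
  assume eq: "face_list M' = map f (face_list M)"
  show "\<forall>d\<in>darts M. f (ccw M d) = ccw M' (f d)"
  proof
    fix d assume d: "d \<in> darts M"
    then have "opp M d \<in> set (face_list M)" by (simp add: face_list_facts(3) G.flip_in)
    then have "f (face_perm M (opp M d)) = face_perm M' (f (opp M d))"
      by (rule cyclic_list_commute[OF face_list_facts(1) face_list_facts(2)[unfolded eq]])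
    then show "f (ccw M d) = ccw M' (f d)"
      using d by (simp add: face_perm_def f_opp G.flip_flip G'.flip_flip f_darts(3))
  qed
next
  assume ccw: "\<forall>d\<in>darts M. f (ccw M d) = ccw M' (f d)"
  have "cyclic_list (face_perm M') (map f (face_list M))"
  proof (rule cyclic_list_map[OF face_list_facts(1)])
    show "inj_on f (set (face_list M))" using f_darts face_list_facts by simp
    show "f (face_perm M x) = face_perm M' (f x)" if "x \<in> set (face_list M)" for x
      using that ccw by (simp add: face_list_facts face_perm_def f_opp G.flip_in)
  qed
  then have "orbit_list (face_perm M') (hd (map f (face_list M))) = map f (face_list M)"
    by (rule orbit_list_cyclic_list)
  moreover have "hd (map f (face_list M)) = root_dart M'"
    using f_root face_list_facts(1,4) by (simp add: hd_map cyclic_list_def)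
  ultimately show "face_list M' = map f (face_list M)" by (simp add: face_list_def)
qed

lemma face_exits_orders:
  "G.exit_orders (face_exits M c)" "G'.exit_orders (face_exits M' c')"
  using G.tour_exit_orders[OF tours(1)] G'.tour_exit_orders[OF tours(2)]
  by (simp_all add: face_exits_def[abs_def])

lemma ccw_cycles:
  assumes "v \<in> dart_label M c ` darts M"
  shows "cyclic_list (ccw N) (face_exits M c v)" "cyclic_list (ccw N') (face_exits M' c' v)"
  using MN MN' assms unfolding corresponds.simps colours_eq by blast+

lemma last_exits:
  assumes "v \<in> G.others"
  shows "last (face_exits M c v) \<in> darts M" "dart_label M c (last (face_exits M c v)) = v"
    "last (face_exits M' c' v) \<in> darts M'" "dart_label M' c' (last (face_exits M' c' v)) = v"
  using face_exits_orders assms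
  by (auto simp: G.exit_orders_def G'.exit_orders_def G.parent_darts_def G'.parent_darts_def others_eq)

lemma trees:
  "S = G.tree_edges (\<lambda>v. last (face_exits M c v))"
  "S' = G'.tree_edges (\<lambda>v. last (face_exits M' c' v))"
  using MN MN' by (simp_all add: last_exit_edges_def)

lemma image_tree:
  "(\<lambda>e. f ` e) ` S = G'.tree_edges (\<lambda>v. f (last (face_exits M c v)))"
  unfolding trees G.tree_edges_def G'.tree_edges_def others_eq image_image
  by (rule image_cong) (simp_all add: last_exits f_opp)

text \<open>From right to left, the last exits are the parent darts of the tree and hence correspond under \<open>f\<close>
  by uniqueness. The first exits follow the last ones in the rotation, or are the root darts. The
  rotation then carries the first exits on to all others.\<close>
lemma exits_iff_ccw_tree:
  "(\<forall>v\<in>dart_label M c ` darts M. face_exits M' c' v = map f (face_exits M c v)) \<longleftrightarrow>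
   (\<forall>d\<in>darts M. f (ccw N d) = ccw N' (f d)) \<and> (\<lambda>e. f ` e) ` S = S'"
proof
  assume eq: "\<forall>v\<in>dart_label M c ` darts M. face_exits M' c' v = map f (face_exits M c v)"
  have "f (ccw N d) = ccw N' (f d)" if d: "d \<in> darts M" for d
  proof (rule cyclic_list_commute[where xs = "face_exits M c (dart_label M c d)"])
    show "cyclic_list (ccw N) (face_exits M c (dart_label M c d))"
      using ccw_cycles d by blast
    show "cyclic_list (ccw N') (map f (face_exits M c (dart_label M c d)))"
      using ccw_cycles(2) eq d by (metis image_eqI)
    show "d \<in> set (face_exits M c (dart_label M c d))"
      using face_exits_orders(1) d by (simp add: G.exit_orders_def)
  qed
  moreover have "f (last (face_exits M c v)) = last (face_exits M' c' v)" if "v \<in> G.others" for v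
  proof -
    have v: "v \<in> dart_label M c ` darts M" using that by (simp add: G.others_def)
    then have "face_exits M' c' v = map f (face_exits M c v)" using eq by blast
    then show ?thesis using ccw_cycles(1)[OF v] by (simp add: cyclic_list_def last_map)
  qed
  then have "(\<lambda>e. f ` e) ` S = S'"
    unfolding image_tree trees(2) G'.tree_edges_def others_eq by (intro image_cong) simp_all
  ultimately show "(\<forall>d\<in>darts M. f (ccw N d) = ccw N' (f d)) \<and> (\<lambda>e. f ` e) ` S = S'" by blast
next
  assume *: "(\<forall>d\<in>darts M. f (ccw N d) = ccw N' (f d)) \<and> (\<lambda>e. f ` e) ` S = S'"
  define p where "p v = last (face_exits M c v)" for v
  define p' where "p' v = last (face_exits M' c' v)" for v
  have p: "G.parent_darts p" and p': "G'.parent_darts p'"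
    using face_exits_orders
    by (simp_all add: G.exit_orders_def G'.exit_orders_def p_def[abs_def] p'_def[abs_def])
  have pv: "p v \<in> darts M" "dart_label M c (p v) = v" if "v \<in> G.others" for v
    using last_exits(1,2)[OF that] by (simp_all add: p_def)
  obtain rank :: "nat \<Rightarrow> nat" where
    rank: "\<And>v. v \<in> G.others \<Longrightarrow> rank (dart_label M c (opp M (p v))) < rank v"
    using p unfolding G.parent_darts_def by blast
  have "rank (dart_label M' c' (opp M' (f (p v)))) < rank v" if "v \<in> G.others" for v
    using rank[OF that] pv[OF that] by (simp add: f_opp[symmetric] f_label G.flip_in)
  then have "G'.parent_darts (\<lambda>v. f (p v))"
    unfolding G'.parent_darts_def others_eq using pv f_darts(3) f_label by auto
  moreover have "G'.tree_edges (\<lambda>v. f (p v)) = G'.tree_edges p'"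
    using * unfolding image_tree trees(2) p_def p'_def by blast
  ultimately have last: "f (p v) = p' v" if "v \<in> G.others" for v
    using G'.parent_darts_unique[OF _ p'] that others_eq by blast
  show "\<forall>v\<in>dart_label M c ` darts M. face_exits M' c' v = map f (face_exits M c v)"
  proof
    fix v assume v: "v \<in> dart_label M c ` darts M"
    note cyc = ccw_cycles[OF v]
    have set: "set (face_exits M c v) \<subseteq> darts M"
      using face_exits_orders(1) v by (auto simp: G.exit_orders_def)
    have hd: "hd (face_exits M' c' v) = f (hd (face_exits M c v))"
    proof (cases "v \<in> G.others")
      case True
      have "hd (face_exits M' c' v) = ccw N' (f (p v))"
        using cyclic_list_last[OF cyc(2)] last[OF True] by (simp add: p'_def)
      also have "\<dots> = f (ccw N (p v))" using * pv(1)[OF True] by simp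
      finally show ?thesis using cyclic_list_last[OF cyc(1)] by (simp add: p_def)
    next
      case False
      then have "v = dart_label M c (root_dart M)" using v by (simp add: G.others_def)
      moreover have "dart_label M' c' (root_dart M') = dart_label M c (root_dart M)"
        using f_label[OF G.r_in] f_root by simp
      ultimately show ?thesis
        using face_exits_orders f_root by (simp add: G.exit_orders_def G'.exit_orders_def)
    qed
    have "cyclic_list (ccw N') (map f (face_exits M c v))"
      using * set inj_on_subset[OF f_darts(1) set] by (intro cyclic_list_map[OF cyc(1)]) auto
    then have "orbit_list (ccw N') (hd (map f (face_exits M c v))) = map f (face_exits M c v)"
      by (rule orbit_list_cyclic_list)
    moreover have "hd (map f (face_exits M c v)) = hd (face_exits M' c' v)"
      using hd cyc(1) by (simp add: hd_map cyclic_list_def)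
    ultimately show "face_exits M' c' v = map f (face_exits M c v)"
      using orbit_list_cyclic_list[OF cyc(2)] by simp
  qed
qed

lemma ccw_iff_ccw_tree:
  "(\<forall>d\<in>darts M. f (ccw M d) = ccw M' (f d)) \<longleftrightarrow>
   (\<forall>d\<in>darts M. f (ccw N d) = ccw N' (f d)) \<and> (\<lambda>e. f ` e) ` S = S'"
  using face_list_map_iff_ccw face_list_map_iff_exits exits_iff_ccw_tree by blast

end

text \<open>Being an isomorphism means, on either side, that \<open>f\<close> carries the tour along the face of \<open>M\<close> over
  to the tour along the face of \<open>M'\<close>.\<close>
lemma corresponds_labelled_iso:
  assumes "rooted_map M" "unicellular M" "rooted_map M'" "unicellular M'"
    and N: "rooted_map N" and MN: "corresponds (M, c) ((N, l), S)"
    and MN': "corresponds (M', c') ((N', l'), S')"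
  shows "labelled_iso f (M, c) (M', c') \<longleftrightarrow>
    labelled_iso f (N, l) (N', l') \<and> (\<lambda>e. f ` e) ` S = S'"
proof -
  have "dart_iso f N l N' l' \<longleftrightarrow> dart_iso f M c M' c'"
    using MN MN' by (auto simp: dart_iso_def bij_betw_apply)
  moreover have "darts N = darts M" using MN by simp
  ultimately show ?thesis
    unfolding labelled_iso_iff_dart_iso[OF assms(1)] labelled_iso_iff_dart_iso[OF N]
    using ccw_iff_ccw_tree[OF assms(1-4) MN MN', of f] by (simp only: conj_assoc cong: conj_cong)
qed

section \<open>The bijection between isomorphism classes\<close>

text \<open>Working with a relation between representatives, total on both sides, avoids choosing
  representatives and transporting structures along isomorphisms.\<close>
lemma bij_betw_quotients:
  assumes r: "equiv A r" and s: "equiv B s"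
    and R: "\<And>a b. R a b \<Longrightarrow> a \<in> A \<and> b \<in> B"
    and left: "\<And>a. a \<in> A \<Longrightarrow> \<exists>b. R a b" and right: "\<And>b. b \<in> B \<Longrightarrow> \<exists>a. R a b"
    and compat: "\<And>a b a' b'. R a b \<Longrightarrow> R a' b' \<Longrightarrow> (a, a') \<in> r \<longleftrightarrow> (b, b') \<in> s"
  shows "\<exists>\<Phi>. bij_betw \<Phi> (A // r) (B // s) \<and>
    (\<forall>U\<in>A // r. \<forall>a\<in>U. \<forall>b\<in>\<Phi> U. \<exists>b'. R a b' \<and> (b', b) \<in> s)"
proof -
  define \<Phi> where "\<Phi> U = {b. \<exists>a\<in>U. \<exists>b'. R a b' \<and> (b', b) \<in> s}" for U
  have trans_s: "(x, z) \<in> s" if "(x, y) \<in> s" "(y, z) \<in> s" for x y z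
    using s that by (meson equivE transD)
  have sym_r: "(y, x) \<in> r" if "(x, y) \<in> r" for x y using r that by (meson equivE symD)
  have \<Phi>: "\<Phi> (r `` {a}) = s `` {b}" if ab: "R a b" for a b
  proof
    show "\<Phi> (r `` {a}) \<subseteq> s `` {b}"
      using compat[OF ab] trans_s by (auto simp: \<Phi>_def)
    have "a \<in> r `` {a}" using R[OF ab] equiv_class_self[OF r] by blast
    then show "s `` {b} \<subseteq> \<Phi> (r `` {a})" using ab by (auto simp: \<Phi>_def)
  qed
  have "bij_betw \<Phi> (A // r) (B // s)"
    unfolding bij_betw_def
  proof
    show "inj_on \<Phi> (A // r)"
    proof (rule inj_onI)
      fix U V assume "U \<in> A // r" "V \<in> A // r" and eq: "\<Phi> U = \<Phi> V"
      then obtain a a' where a: "U = r `` {a}" "a \<in> A" "V = r `` {a'}" "a' \<in> A"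
        by (auto elim!: quotientE)
      then obtain b b' where b: "R a b" "R a' b'" using left by blast
      then have "s `` {b} = s `` {b'}" using eq \<Phi> a by simp
      then have "(b, b') \<in> s" using s R b by (simp add: eq_equiv_class_iff)
      then show "U = V" using compat b a r by (simp add: equiv_class_eq)
    qed
    show "\<Phi> ` (A // r) = B // s"
    proof
      show "\<Phi> ` (A // r) \<subseteq> B // s"
      proof
        fix V assume "V \<in> \<Phi> ` (A // r)"
        then obtain a where a: "V = \<Phi> (r `` {a})" "a \<in> A" by (auto elim!: quotientE)
        then obtain b where "R a b" using left by blast
        then show "V \<in> B // s" using a(1) \<Phi> R by (auto intro: quotientI)
      qed
      show "B // s \<subseteq> \<Phi> ` (A // r)"
      proof
        fix V assume "V \<in> B // s"
        then obtain b where b: "V = s `` {b}" "b \<in> B" by (auto elim!: quotientE)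
        then obtain a where a: "R a b" using right by blast
        then have "\<Phi> (r `` {a}) = V" "r `` {a} \<in> A // r" using \<Phi> R b by (auto intro: quotientI)
        then show "V \<in> \<Phi> ` (A // r)" by blast
      qed
    qed
  qed
  moreover have "\<exists>b'. R a b' \<and> (b', b) \<in> s" if U: "U \<in> A // r" "a \<in> U" "b \<in> \<Phi> U" for U a b
  proof -
    have "a \<in> A" using U r in_quotient_imp_subset by blast
    then obtain b' where b': "R a b'" using left by blast
    have "U = r `` {a}" using U r by (metis Image_singleton_iff equiv_class_eq quotientE)
    then show ?thesis using b' \<Phi>[OF b'] U(3) by auto
  qed
  ultimately show ?thesis by blast
qed

theorem theorem5:
  fixes n q :: nat
  assumes "n > 0" and "q > 0"
  shows "\<exists>\<Phi>. bij_betw \<Phi> (colored_unicellular_maps n q) (tree_rooted_maps n q) \<and>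
    (\<forall>U\<in>colored_unicellular_maps n q. \<forall>(M, c)\<in>U. \<forall>((N, l), T)\<in>\<Phi> U.
      \<forall>i\<in>{1..q}. \<forall>j\<in>{1..q}. edge_count M c i j = edge_count N l i j)"
proof -
  define R where "R X Z \<longleftrightarrow> X \<in> pre_colored_unicellular n q \<and> Z \<in> pre_tree_rooted n q \<and>
    corresponds X Z" for X Z
  have compat: "(X, X') \<in> colored_iso_rel n q \<longleftrightarrow> (Z, Z') \<in> tree_iso_rel n q"
    if "R X Z" "R X' Z'" for X X' Z Z'
  proof -
    obtain M c M' c' N l S N' l' S' where
      "X = (M, c)" "X' = (M', c')" "Z = ((N, l), S)" "Z' = ((N', l'), S')"
      by (metis surj_pair)
    moreover have "labelled_iso f (M, c) (M', c') \<longleftrightarrow>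
        labelled_iso f (N, l) (N', l') \<and> (\<lambda>e. f ` e) ` S = S'" for f
      using that calculation
      by (intro corresponds_labelled_iso)
        (auto simp: R_def pre_colored_unicellular_def pre_tree_rooted_def simp del: corresponds.simps)
    ultimately show ?thesis
      using that by (auto simp: R_def colored_iso_rel_def tree_iso_rel_def simp del: labelled_iso.simps)
  qed
  have left: "\<exists>Z. R X Z" if "X \<in> pre_colored_unicellular n q" for X
    using corresponds_tree_exists that unfolding R_def by (metis surj_pair)
  have right: "\<exists>X. R X Z" if "Z \<in> pre_tree_rooted n q" for Z
    using corresponds_unicellular_exists that unfolding R_def by (metis surj_pair)
  obtain \<Phi> where \<Phi>: "bij_betw \<Phi> (colored_unicellular_maps n q) (tree_rooted_maps n q)"
    and cls: "\<And>U X Z. U \<in> colored_unicellular_maps n q \<Longrightarrow> X \<in> U \<Longrightarrow> Z \<in> \<Phi> U \<Longrightarrow>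
      \<exists>Z'. R X Z' \<and> (Z', Z) \<in> tree_iso_rel n q"
    using bij_betw_quotients[of _ _ _ _ R, OF equiv_colored_iso_rel equiv_tree_iso_rel _ left right compat]
    unfolding colored_unicellular_maps_def tree_rooted_maps_def R_def by blast
  have "edge_count M c i j = edge_count N l i j"
    if U: "U \<in> colored_unicellular_maps n q" "(M, c) \<in> U" "((N, l), T) \<in> \<Phi> U" for U M c N l T i j
  proof -
    obtain N' l' T' where R: "R (M, c) ((N', l'), T')"
      and iso: "(((N', l'), T'), ((N, l), T)) \<in> tree_iso_rel n q"
      using cls[OF U] by (metis surj_pair)
    have "edge_count M c i j = edge_count N' l' i j"
      using R by (intro edge_count_cong)
        (auto simp: R_def pre_colored_unicellular_def edges_def edge_of_def)
    moreover obtain f where "labelled_iso f (N', l') (N, l)" using iso by (auto simp: tree_iso_rel_def)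
    then have "edge_count N' l' i j = edge_count N l i j"
      using R by (intro edge_count_labelled_iso) (auto simp: R_def pre_tree_rooted_def)
    ultimately show ?thesis by simp
  qed
  then show ?thesis using \<Phi> by (intro exI[of _ \<Phi>]) auto
qed

end
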